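(* Consider a graph problem on a fixed graph whose instances are given by edge weights $c\in\mathbb{R}^m$ drawn from an unknown distribution $\mathcal{D}$, and let $h^*(c)\in\mathcal{H}\subseteq\mathbb{R}^d$ denote an optimal hint for instance $c$. Define $\ell_1(h,c)=\|h^*(c)-h\|_1$. Assume (bounded range) there is $M$ such that for every $h\in\mathcal{H}$, $h_i\in[-M,M]$ for all $i$; and (efficient optimization) there is a polynomial-time algorithm that, given i.i.d. samples $c_1,\dots,c_s\sim\mathcal{D}$, finds $h\in\mathcal{H}$ minimizing $\sum_{i=1}^s\|h^*(c_i)-h\|_1$. Then there is a polynomial-time algorithm that, given $s=O\big((dM/\epsilon)^2(d\log d+\log(1/\delta))\big)$ i.i.d. samples from $\mathcal{D}$, returns $h\in\mathcal{H}$ such that, with probability at least $1-\delta$, \[\mathbb{E}_{c\sim\mathcal{D}}\ell_1(h,c)\le \min_{h'\in\mathcal{H}}\mathbb{E}_{c\sim\mathcal{D}}\ell_1(h',c)+\epsilon.\]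
   Context: The map $c\mapsto h^*(c)$ is an arbitrary fixed problem-dependent function (e.g. an optimal LP dual solution); no assumption is made on $\mathcal{D}$. *)

theory Defs
  imports "HOL-Probability.Probability" "HOL-Computational_Algebra.Polynomial"
begin

text \<open>
  Since instances are real vectors, ``algorithm'' means a program for a real random access machine
  in the style of Blum, Shub and Smale: unit-cost exact field operations and comparisons on real
  cells, arbitrary real constants, and no rounding. Addresses live in separate index registers,
  which can only be set to constants, copied, incremented, decremented and tested for equality, so
  that no super-polynomial amount of information can be packed into them in polynomially many steps.
\<close>

datatype instr =
    Const nat real
  | Add nat nat nat
  | Sub nat nat nat
  | Mul nat nat nat
  | Div nat nat nat
  | Load nat nat
  | Store nat nat
  | IConst nat nat
  | ICopy nat nat
  | IInc nat
  | IDec nat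
  | JumpLe nat nat nat
  | JumpIEq nat nat nat
  | Halt

text \<open>A configuration consists of program counter, index registers and real memory.\<close>

type_synonym config = "nat \<times> (nat \<Rightarrow> nat) \<times> (nat \<Rightarrow> real)"

fun exec :: "instr \<Rightarrow> config \<Rightarrow> config" where
  "exec (Const i x) (pc, a, r) = (Suc pc, a, r(i := x))"
| "exec (Add i j k) (pc, a, r) = (Suc pc, a, r(i := r j + r k))"
| "exec (Sub i j k) (pc, a, r) = (Suc pc, a, r(i := r j - r k))"
| "exec (Mul i j k) (pc, a, r) = (Suc pc, a, r(i := r j * r k))"
| "exec (Div i j k) (pc, a, r) = (Suc pc, a, r(i := r j / r k))"
| "exec (Load i j) (pc, a, r) = (Suc pc, a, r(i := r (a j)))"
| "exec (Store i j) (pc, a, r) = (Suc pc, a, r(a i := r j))"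
| "exec (IConst i n) (pc, a, r) = (Suc pc, a(i := n), r)"
| "exec (ICopy i j) (pc, a, r) = (Suc pc, a(i := a j), r)"
| "exec (IInc i) (pc, a, r) = (Suc pc, a(i := Suc (a i)), r)"
| "exec (IDec i) (pc, a, r) = (Suc pc, a(i := a i - 1), r)"
| "exec (JumpLe i j l) (pc, a, r) = ((if r i \<le> r j then l else Suc pc), a, r)"
| "exec (JumpIEq i j l) (pc, a, r) = ((if a i = a j then l else Suc pc), a, r)"
| "exec Halt c = c"

definition halted :: "instr list \<Rightarrow> config \<Rightarrow> bool" where
  "halted P c \<longleftrightarrow> length P \<le> fst c \<or> P ! fst c = Halt"

definition step :: "instr list \<Rightarrow> config \<Rightarrow> config" where
  "step P c = (if halted P c then c else exec (P ! fst c) c)"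

text \<open>The input occupies the first memory cells, and its length is in index register 0.\<close>

definition init_config :: "real list \<Rightarrow> config" where
  "init_config xs =
     (0, (\<lambda>_. 0)(0 := length xs), (\<lambda>i. if i < length xs then xs ! i else 0))"

definition run :: "instr list \<Rightarrow> real list \<Rightarrow> nat \<Rightarrow> config" where
  "run P xs t = (step P ^^ t) (init_config xs)"

definition poly_time_on :: "real list set \<Rightarrow> instr list \<Rightarrow> bool" where
  "poly_time_on X P \<longleftrightarrow>
     (\<exists>p :: nat poly. \<forall>xs\<in>X. \<exists>t \<le> poly p (length xs). halted P (run P xs t))"

text \<open>
  The output vector in \<open>\<real>\<^sup>d\<close> is read off the first \<open>d\<close> memory cells on halting.
  The value is only meaningful for inputs on which the program halts.
\<close>

definition prog_output :: "instr list \<Rightarrow> nat \<Rightarrow> real list \<Rightarrow> (nat \<Rightarrow> real)" where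
  "prog_output P d xs =
     restrict (snd (snd (run P xs (LEAST t. halted P (run P xs t))))) {..<d}"

text \<open>
  \<open>\<real>\<^sup>n\<close> with its Borel sigma-algebra. The dimension is a term because the
  constant hidden in the sample bound must not depend on it. Vectors are extensional functions.
\<close>

abbreviation Rvec :: "nat \<Rightarrow> (nat \<Rightarrow> real) measure" where
  "Rvec n \<equiv> \<Pi>\<^sub>M i\<in>{..<n}. borel"

definition l1_loss :: "nat \<Rightarrow> ((nat \<Rightarrow> real) \<Rightarrow> (nat \<Rightarrow> real)) \<Rightarrow> (nat \<Rightarrow> real) \<Rightarrow> (nat \<Rightarrow> real) \<Rightarrow> real"
  where "l1_loss d hopt h c = (\<Sum>i<d. \<bar>hopt c i - h i\<bar>)"

definition exp_loss ::
    "nat \<Rightarrow> ((nat \<Rightarrow> real) \<Rightarrow> (nat \<Rightarrow> real)) \<Rightarrow> (nat \<Rightarrow> real) measure \<Rightarrow> (nat \<Rightarrow> real) \<Rightarrow> real"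
  where "exp_loss d hopt D h = (LINT c|D. l1_loss d hopt h c)"

definition encode :: "nat \<Rightarrow> (nat \<Rightarrow> real) list \<Rightarrow> real list" where
  "encode m cs = concat (map (\<lambda>c. map c [0..<m]) cs)"

definition sample_inputs :: "nat \<Rightarrow> real list set" where
  "sample_inputs m = encode m ` lists (space (Rvec m))"

definition minimizes_empirical_loss ::
    "nat \<Rightarrow> nat \<Rightarrow> (nat \<Rightarrow> real) set \<Rightarrow> ((nat \<Rightarrow> real) \<Rightarrow> (nat \<Rightarrow> real)) \<Rightarrow> instr list \<Rightarrow> bool"
  where "minimizes_empirical_loss m d H hopt P \<longleftrightarrow>
    (\<forall>cs \<in> lists (space (Rvec m)).
       is_arg_min (\<lambda>h. \<Sum>c\<leftarrow>cs. l1_loss d hopt h c) (\<lambda>h. h \<in> H) (prog_output P d (encode m cs)))"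

end

theory Submission
  imports Defs
begin

text \<open>
  The hypothesised program is itself the learner; its output is a measurable function of the samples.
  For \<open>x, h \<in> [-M, M]\<close>, the distance \<open>\<bar>x - h\<bar>\<close> is the integral over \<open>t \<in> [-M, M]\<close> of the mismatch
  of the indicators of \<open>x \<le> t\<close> and \<open>h \<le> t\<close>. Hence the empirical and the expected loss of every
  hint differ by at most the sum over the coordinates of \<open>\<integral> \<bar>F\<^sub>s(t) - F(t)\<bar> dt\<close>, where \<open>F\<close> and \<open>F\<^sub>s\<close> are
  the true and the empirical distribution function of a coordinate of \<open>h\<^sup>*(c)\<close>. Jensen's inequality and
  Hoeffding's lemma bound the exponential moment of this sum, and the excess loss exceeds \<open>\<epsilon>\<close> with
  probability at most \<open>2 exp (- s (\<epsilon> / (d M))\<^sup>2 / 8)\<close>.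

  For \<open>d \<ge> 2\<close> the term \<open>d ln d\<close> absorbs the factor 2. For \<open>d = 1\<close> it vanishes, and if \<open>\<delta>\<close> is close
  to 1 the claim needs a lower bound of order \<open>s (\<epsilon> / M)\<^sup>2\<close> on the success probability. There the
  empirical minimiser is a sample median, which is good as soon as fewer than half of the samples
  fall to either side of the interval of good values. Each side has probability at most
  \<open>1/2 - \<epsilon> / (8 M)\<close>, and the probability that both counts stay below \<open>s/2\<close> is estimated by
  differentiating its closed form in the side probability.
\<close>

subsection \<open>Measurability of program outputs\<close>

text \<open>Indirect addressing: an address takes countably many values, so a read at a random
  address splits into reads at fixed addresses.\<close>

lemma measurable_count_space_app:
  fixes a :: "'a \<Rightarrow> nat \<Rightarrow> 'b"
  assumes "\<And>k. (\<lambda>w. a w k) \<in> M \<rightarrow>\<^sub>M N" "i \<in> M \<rightarrow>\<^sub>M count_space UNIV"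
  shows "(\<lambda>w. a w (i w)) \<in> M \<rightarrow>\<^sub>M N"
  using measurable_compose_countable[of "\<lambda>k w. a w k" M N i] assms by simp

text \<open>Measurability register by register and cell by cell stands in for a sigma-algebra on
  \<open>config\<close>, since instructions act on individual registers and cells.\<close>

definition measurable_config :: "'a measure \<Rightarrow> ('a \<Rightarrow> config) \<Rightarrow> bool" where
  "measurable_config M f \<longleftrightarrow>
     (\<lambda>w. fst (f w)) \<in> M \<rightarrow>\<^sub>M count_space UNIV \<and>
     (\<forall>k. (\<lambda>w. fst (snd (f w)) k) \<in> M \<rightarrow>\<^sub>M count_space UNIV) \<and>
     (\<forall>k. (\<lambda>w. snd (snd (f w)) k) \<in> borel_measurable M)"

lemma measurable_config_exec:
  assumes "measurable_config M f"
  shows "measurable_config M (\<lambda>w. exec I (f w))"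
proof -
  define pc where "pc w = fst (f w)" for w
  define a where "a w = fst (snd (f w))" for w
  define r where "r w = snd (snd (f w))" for w
  have f: "f w = (pc w, a w, r w)" for w by (simp add: pc_def a_def r_def)
  have [measurable]: "pc \<in> M \<rightarrow>\<^sub>M count_space UNIV"
    and [measurable]: "\<And>k. (\<lambda>w. a w k) \<in> M \<rightarrow>\<^sub>M count_space UNIV"
    and [measurable]: "\<And>k. (\<lambda>w. r w k) \<in> borel_measurable M"
    using assms by (auto simp: measurable_config_def pc_def[abs_def] a_def r_def)
  have [measurable]: "(\<lambda>w. r w (a w k)) \<in> borel_measurable M" for k
    by (rule measurable_count_space_app) measurable
  \<comment> \<open>For \<open>JumpIEq\<close>: the comparison of two random indices splits over the
    countably many values of one of them.\<close>
  have [measurable]: "Measurable.pred M (\<lambda>w. a w i = a w j)" for i j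
    by (rule measurable_compose_countable[where f = "\<lambda>n w. a w i = n" and g = "\<lambda>w. a w j"]) measurable
  show ?thesis
    by (cases I) (simp_all add: f measurable_config_def fun_upd_def)
qed

lemma measurable_config_halted:
  assumes "measurable_config M f"
  shows "(\<lambda>w. halted P (f w)) \<in> M \<rightarrow>\<^sub>M count_space UNIV"
proof -
  have [measurable]: "(\<lambda>w. fst (f w)) \<in> M \<rightarrow>\<^sub>M count_space UNIV"
    using assms by (simp add: measurable_config_def)
  show ?thesis unfolding halted_def by measurable
qed

lemma measurable_config_step:
  assumes f: "measurable_config M f"
  shows "measurable_config M (\<lambda>w. step P (f w))"
proof -
  have [measurable]: "(\<lambda>w. halted P (f w)) \<in> M \<rightarrow>\<^sub>M count_space UNIV"
    using f by (rule measurable_config_halted)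
  have pc[measurable]: "(\<lambda>w. fst (f w)) \<in> M \<rightarrow>\<^sub>M count_space UNIV"
    using f by (simp add: measurable_config_def)
  have e: "measurable_config M (\<lambda>w. exec (P ! n) (f w))" for n
    using f by (rule measurable_config_exec)
  \<comment> \<open>The instruction itself is random through the program counter; for each of its
    countably many values the instruction is fixed.\<close>
  have [measurable]: "(\<lambda>w. fst (exec (P ! fst (f w)) (f w))) \<in> M \<rightarrow>\<^sub>M count_space UNIV"
    by (rule measurable_compose_countable[OF _ pc]) (use e in \<open>simp add: measurable_config_def\<close>)
  have [measurable]: "(\<lambda>w. fst (snd (exec (P ! fst (f w)) (f w))) k) \<in> M \<rightarrow>\<^sub>M count_space UNIV" for k
    by (rule measurable_compose_countable[OF _ pc]) (use e in \<open>simp add: measurable_config_def\<close>)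
  have [measurable]: "(\<lambda>w. snd (snd (exec (P ! fst (f w)) (f w))) k) \<in> borel_measurable M" for k
    by (rule measurable_compose_countable[OF _ pc]) (use e in \<open>simp add: measurable_config_def\<close>)
  have [measurable]: "\<And>k. (\<lambda>w. fst (snd (f w)) k) \<in> M \<rightarrow>\<^sub>M count_space UNIV"
    "\<And>k. (\<lambda>w. snd (snd (f w)) k) \<in> borel_measurable M"
    using f by (auto simp: measurable_config_def)
  show ?thesis
    unfolding measurable_config_def step_def
    by (simp add: if_distrib[of fst] if_distrib[of snd] if_distribR)
qed

text \<open>The common input length \<open>n\<close> makes index register 0 initially constant; from
  there each step preserves measurability.\<close>

lemma measurable_config_run:
  assumes len: "\<And>w. w \<in> space M \<Longrightarrow> length (x w) = n"
    and x: "\<And>i. i < n \<Longrightarrow> (\<lambda>w. x w ! i) \<in> borel_measurable M"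
  shows "measurable_config M (\<lambda>w. run P (x w) t)"
proof (induction t)
  case 0
  have 1: "(\<lambda>w. length (x w)) \<in> M \<rightarrow>\<^sub>M count_space UNIV"
    using measurable_const[of n "count_space UNIV" M] len by (subst measurable_cong) auto
  have 2: "(\<lambda>w. if i < length (x w) then x w ! i else 0) \<in> borel_measurable M" for i
  proof -
    have "(\<lambda>w. if i < n then x w ! i else 0) \<in> borel_measurable M"
      using x[of i] by (cases "i < n") auto
    then show ?thesis using len by (subst measurable_cong) auto
  qed
  show ?case
    using 1 2 by (auto simp: run_def init_config_def measurable_config_def)
next
  case (Suc t)
  then show ?case using measurable_config_step[of M "\<lambda>w. run P (x w) t" P] by (simp add: run_def)
qed

text \<open>The halting time is a measurable natural number, so the output is memory read at a
  countably valued random time. Where the program never halts, \<open>LEAST\<close> has one fixed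
  default value.\<close>

lemma measurable_prog_output:
  assumes "\<And>w. w \<in> space M \<Longrightarrow> length (x w) = n"
    and "\<And>i. i < n \<Longrightarrow> (\<lambda>w. x w ! i) \<in> borel_measurable M"
  shows "(\<lambda>w. prog_output P d (x w)) \<in> M \<rightarrow>\<^sub>M Rvec d"
proof -
  have run: "measurable_config M (\<lambda>w. run P (x w) t)" for t
    using assms by (rule measurable_config_run)
  have T: "(\<lambda>w. LEAST t. halted P (run P (x w) t)) \<in> M \<rightarrow>\<^sub>M count_space UNIV"
    by (rule measurable_Least) (rule measurable_config_halted[OF run])
  show ?thesis unfolding prog_output_def
    by (rule measurable_restrict, rule measurable_compose_countable[OF _ T])
      (use run in \<open>simp add: measurable_config_def\<close>)
qed

section \<open>Samples as a flat input list\<close>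

lemma encode_samples:
  "encode m (map w [0..<s]) = map (\<lambda>i. w (i div m) (i mod m)) [0..<s * m]"
proof (induction s)
  case 0
  then show ?case by (simp add: encode_def)
next
  case (Suc s)
  have "map (w s) [0..<m] = map (\<lambda>i. w (i div m) (i mod m)) [s * m..<m + s * m]"
    by (rule nth_equalityI) auto
  moreover have "[0..<Suc s * m] = [0..<s * m] @ [s * m..<m + s * m]"
    using upt_add_eq_append[of 0 "s * m" m] by (simp add: add.commute)
  ultimately show ?case using Suc by (simp add: encode_def)
qed

lemma measurable_encode_samples:
  assumes "sets D = sets (Rvec m)" "i < s * m"
  shows "(\<lambda>w. encode m (map w [0..<s]) ! i) \<in> borel_measurable (\<Pi>\<^sub>M j\<in>{..<s}. D)"
proof -
  have [simp]: "i div m < s" "i mod m < m"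
    using assms(2) by (auto simp: less_mult_imp_div_less) (metis assms(2) mod_less_divisor mult_0_right neq0_conv not_less_zero)
  have "(\<lambda>x. x (i mod m)) \<in> borel_measurable D"
    unfolding measurable_cong_sets[OF assms(1) refl] by simp
  then have "(\<lambda>w. w (i div m) (i mod m)) \<in> borel_measurable (\<Pi>\<^sub>M j\<in>{..<s}. D)"
    by (rule measurable_compose[rotated]) simp
  then show ?thesis using assms(2) by (simp add: encode_samples)
qed

subsection \<open>Two binomial counts staying below half\<close>

text \<open>Each of \<open>s\<close> independent trials yields a first outcome with probability
  \<open>p\<close>, a second with \<open>q\<close>, or neither; the value is the probability of
  fewer than \<open>a\<close> first and fewer than \<open>b\<close> second outcomes. The recursion
  conditions on one trial, which makes comparisons inductive; the guard keeps \<open>a - 1\<close>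
  and \<open>b - 1\<close> from truncating.\<close>

primrec below_prob :: "real \<Rightarrow> real \<Rightarrow> nat \<Rightarrow> nat \<Rightarrow> nat \<Rightarrow> real" where
  "below_prob p q 0 a b = (if 0 < a \<and> 0 < b then 1 else 0)"
| "below_prob p q (Suc s) a b = (if 0 < a \<and> 0 < b then
     p * below_prob p q s (a - 1) b + q * below_prob p q s a (b - 1) +
     (1 - p - q) * below_prob p q s a b else 0)"

lemma below_prob_0 [simp]: "below_prob p q s 0 b = 0" "below_prob p q s a 0 = 0"
  by (cases s; simp)+

lemma below_prob_nonneg:
  assumes "0 \<le> p" "0 \<le> q" "p + q \<le> 1"
  shows "0 \<le> below_prob p q s a b"
  using assms by (induction s arbitrary: a b) auto

lemma below_prob_mono:
  assumes pq: "0 \<le> p" "0 \<le> q" "p + q \<le> 1" and "a \<le> a'" "b \<le> b'"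
  shows "below_prob p q s a b \<le> below_prob p q s a' b'"
  using assms(4,5)
proof (induction s arbitrary: a b a' b')
  case (Suc s)
  show ?case
  proof (cases "0 < a \<and> 0 < b")
    case True
    with Suc.prems pq show ?thesis
      by (auto intro!: add_mono mult_left_mono Suc.IH)
  next
    case False
    then show ?thesis using below_prob_nonneg[OF pq, of "Suc s" a' b'] by (auto simp del: below_prob.simps(2))
  qed
qed auto

text \<open>An extra trial never lowers a count: the three branches average values whose thresholds
  are at most \<open>a\<close> and \<open>b\<close>.\<close>

lemma below_prob_Suc_le:
  assumes pq: "0 \<le> p" "0 \<le> q" "p + q \<le> 1"
  shows "below_prob p q (Suc s) a b \<le> below_prob p q s a b"
proof (cases "0 < a \<and> 0 < b")
  case True
  have "below_prob p q (Suc s) a b \<le> p * below_prob p q s a b + q * below_prob p q s a b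
      + (1 - p - q) * below_prob p q s a b"
    using True pq by (auto intro!: add_mono mult_left_mono below_prob_mono)
  also have "\<dots> = below_prob p q s a b" by (simp add: algebra_simps)
  finally show ?thesis .
qed auto

text \<open>Raising \<open>p\<close> or \<open>q\<close> moves weight from the branch that keeps
  both thresholds to a branch that lowers one, whose value is no larger.\<close>

lemma below_prob_antimono:
  assumes "0 \<le> p" "0 \<le> q" "p \<le> p'" "q \<le> q'" "p' + q' \<le> 1"
  shows "below_prob p' q' s a b \<le> below_prob p q s a b"
proof (induction s arbitrary: a b)
  case (Suc s)
  show ?case
  proof (cases "0 < a \<and> 0 < b")
    case True
    let ?g = "below_prob p q s"
    have "below_prob p' q' (Suc s) a b \<le> p' * ?g (a - 1) b + q' * ?g a (b - 1) + (1 - p' - q') * ?g a b"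
      using True assms by (auto intro!: add_mono mult_left_mono Suc.IH)
    also have "\<dots> = p * ?g (a - 1) b + q * ?g a (b - 1) + (1 - p - q) * ?g a b
        - (p' - p) * (?g a b - ?g (a - 1) b) - (q' - q) * (?g a b - ?g a (b - 1))"
      by (simp add: algebra_simps)
    also have "\<dots> \<le> p * ?g (a - 1) b + q * ?g a (b - 1) + (1 - p - q) * ?g a b"
    proof -
      have "0 \<le> (p' - p) * (?g a b - ?g (a - 1) b)" "0 \<le> (q' - q) * (?g a b - ?g a (b - 1))"
        using assms by (auto intro!: mult_nonneg_nonneg simp: below_prob_mono)
      then show ?thesis by linarith
    qed
    finally show ?thesis using True by simp
  qed auto
qed simp

section \<open>Closed form through binomial distribution functions\<close>

definition binomial_cdf :: "real \<Rightarrow> nat \<Rightarrow> nat \<Rightarrow> real" where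
  "binomial_cdf p s a = (\<Sum>l<a. real (s choose l) * p ^ l * (1 - p) ^ (s - l))"

text \<open>This conditions on one trial. \<open>binomial_cdf\<close> counts strictly fewer than
  \<open>a\<close> successes, to match \<open>below_prob\<close>. Raising the threshold adds a
  summand to each distribution function, and Pascal's rule matches them.\<close>

lemma binomial_cdf_Suc_Suc:
  "binomial_cdf p (Suc s) (Suc a) = p * binomial_cdf p s a + (1 - p) * binomial_cdf p s (Suc a)"
proof (induction a)
  case 0
  then show ?case by (simp add: binomial_cdf_def)
next
  case (Suc a)
  \<comment> \<open>Truncated subtraction breaks \<open>s - a = Suc (s - Suc a)\<close> only for
    \<open>s < Suc a\<close>, where the binomial coefficient vanishes.\<close>
  have *: "real (s choose Suc a) * (1 - p) ^ (s - a) = real (s choose Suc a) * ((1 - p) * (1 - p) ^ (s - Suc a))"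
  proof (cases "Suc a \<le> s")
    case True
    then have "s - a = Suc (s - Suc a)" by simp
    then show ?thesis by simp
  qed (simp add: binomial_eq_0)
  have "binomial_cdf p (Suc s) (Suc (Suc a)) = binomial_cdf p (Suc s) (Suc a) +
     real (Suc s choose Suc a) * p ^ Suc a * (1 - p) ^ (s - a)"
    by (simp add: binomial_cdf_def)
  also have "real (Suc s choose Suc a) * p ^ Suc a * (1 - p) ^ (s - a) =
     p * (real (s choose a) * p ^ a * (1 - p) ^ (s - a)) +
     p ^ Suc a * (real (s choose Suc a) * (1 - p) ^ (s - a))"
    by (simp add: algebra_simps)
  also have "p ^ Suc a * (real (s choose Suc a) * (1 - p) ^ (s - a)) =
     (1 - p) * (real (s choose Suc a) * p ^ Suc a * (1 - p) ^ (s - Suc a))"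
    unfolding * by simp
  finally show ?case using Suc by (simp add: binomial_cdf_def algebra_simps)
qed

lemma binomial_cdf_0 [simp]: "binomial_cdf p s 0 = 0"
  by (simp add: binomial_cdf_def)

lemma binomial_cdf_eq_1: "s < a \<Longrightarrow> binomial_cdf p s a = 1"
proof (induction s arbitrary: a)
  case 0
  then show ?case by (cases a) (simp_all add: binomial_cdf_def sum.lessThan_Suc_shift del: sum.lessThan_Suc)
next
  case (Suc s)
  then obtain a' where "a = Suc a'" "s < a'" by (cases a) auto
  then show ?case using Suc.IH[of a'] Suc.IH[of a] by (simp add: binomial_cdf_Suc_Suc)
qed

lemma binomial_cdf_self: "binomial_cdf p s s = 1 - p ^ s"
  using binomial_cdf_eq_1[of s "Suc s" p] by (simp add: binomial_cdf_def)

text \<open>Inclusion-exclusion: if \<open>a + b \<ge> s\<close>, both counts can reach their thresholds only when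
  \<open>a + b = s\<close>, and then they equal \<open>a\<close> and \<open>b\<close>.\<close>

lemma below_prob_eq:
  assumes "s \<le> a + b"
  shows "below_prob p q s a b = binomial_cdf p s a + binomial_cdf q s b - 1 +
    (if a + b = s then real (s choose a) * p ^ a * q ^ b else 0)"
  using assms
proof (induction s arbitrary: a b)
  case 0
  then show ?case by (auto simp: binomial_cdf_eq_1)
next
  case (Suc s)
  \<comment> \<open>With a zero threshold the left side is 0. If the other threshold is
    \<open>Suc s\<close>, the correction term cancels the power in \<open>binomial_cdf_self\<close>;
    if it is larger, the distribution functions sum to 1.\<close>
  consider "a = 0" | "b = 0" | a' b' where "a = Suc a'" "b = Suc b'"
    by (metis not0_implies_Suc)
  then show ?case
  proof cases
    case 1
    then show ?thesis using Suc.prems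
      by (cases "b = Suc s") (simp_all add: binomial_cdf_self binomial_cdf_eq_1)
  next
    case 2
    then show ?thesis using Suc.prems
      by (cases "a = Suc s") (simp_all add: binomial_cdf_self binomial_cdf_eq_1)
  next
    case 3
    have *: "below_prob p q (Suc s) a b = p * below_prob p q s a' b + q * below_prob p q s a b'
        + (1 - p - q) * below_prob p q s a b"
      using 3 by simp
    \<comment> \<open>For \<open>a + b = Suc s\<close>, the correction terms of the two branches
      that lower a threshold combine by Pascal's rule; the third branch has \<open>a + b > s\<close>
      and contributes none.\<close>
    show ?thesis
      unfolding * using Suc.prems 3
      by (simp add: Suc.IH binomial_cdf_Suc_Suc[of _ _ a'] binomial_cdf_Suc_Suc[of _ _ b'])
        (auto simp: algebra_simps)
  qed
qed

text \<open>The derivative of each summand is a difference of neighbouring terms, brought to a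
  common form by the absorption identities \<open>b\<close> and \<open>c\<close>. The sum telescopes
  to its last term.\<close>

lemma binomial_cdf_has_derivative:
  "((\<lambda>p. binomial_cdf p (Suc s) (Suc a)) has_real_derivative
     - real (Suc s) * real (s choose a) * p ^ a * (1 - p) ^ (s - a)) (at p)"
proof (induction a)
  case 0
  have eq: "(\<lambda>p. binomial_cdf p (Suc s) (Suc 0)) = (\<lambda>p. (1 - p) ^ Suc s)"
    by (simp add: binomial_cdf_def)
  have "((\<lambda>p. 1 - p) has_real_derivative -1) (at p)"
    by (auto intro!: derivative_eq_intros)
  from DERIV_power[OF this, of "Suc s"] show ?case
    unfolding eq by (rule DERIV_cong) (simp del: of_nat_Suc)
next
  case (Suc a)
  have b: "real (Suc s choose Suc a) * real (Suc a) = real (Suc s) * real (s choose a)"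
    by (metis Suc_times_binomial_eq of_nat_mult mult.commute)
  have c: "real (Suc s choose Suc a) * real (s - a) = real (Suc s) * real (s choose Suc a)"
    using binomial_absorb_comp[of "Suc s" "Suc a"]
    by (metis diff_Suc_1 diff_Suc_Suc mult.commute of_nat_mult)
  have eq: "(\<lambda>p. binomial_cdf p (Suc s) (Suc (Suc a))) = (\<lambda>p. binomial_cdf p (Suc s) (Suc a) +
     real (Suc s choose Suc a) * (p ^ Suc a * (1 - p) ^ (s - a)))"
    by (simp add: binomial_cdf_def fun_eq_iff)
  have "((\<lambda>p. real (Suc s choose Suc a) * (p ^ Suc a * (1 - p) ^ (s - a))) has_real_derivative
      real (Suc s choose Suc a) * (real (Suc a) * p ^ a * (1 - p) ^ (s - a)
        - p ^ Suc a * (real (s - a) * (1 - p) ^ (s - a - 1)))) (at p)"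
    by (rule derivative_eq_intros refl)+ (simp add: algebra_simps)
  also have "real (Suc s choose Suc a) * (real (Suc a) * p ^ a * (1 - p) ^ (s - a)
        - p ^ Suc a * (real (s - a) * (1 - p) ^ (s - a - 1))) =
      (real (Suc s choose Suc a) * real (Suc a)) * p ^ a * (1 - p) ^ (s - a)
        - p ^ Suc a * ((real (Suc s choose Suc a) * real (s - a)) * (1 - p) ^ (s - a - 1))"
    by (simp only: right_diff_distrib mult.assoc mult.left_commute)
  finally have D: "((\<lambda>p. real (Suc s choose Suc a) * (p ^ Suc a * (1 - p) ^ (s - a))) has_real_derivative
      real (Suc s) * real (s choose a) * p ^ a * (1 - p) ^ (s - a)
        - p ^ Suc a * (real (Suc s) * real (s choose Suc a) * (1 - p) ^ (s - a - 1))) (at p)"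
    unfolding b c .
  show ?case unfolding eq
    by (rule DERIV_cong[OF DERIV_add[OF Suc.IH D]]) (simp del: binomial_Suc_Suc power_Suc of_nat_Suc)
qed

section \<open>Estimates for two sides of probability \<open>1/2 - x\<close>\<close>

lemma central_binomial_ge:
  assumes "0 < k"
  shows "4 ^ k \<le> 2 * sqrt (real k) * real (2 * k choose k)"
proof -
  \<comment> \<open>Squaring removes the root, and the ratio of consecutive central binomial
    coefficients carries the induction.\<close>
  have *: "16 ^ Suc n \<le> 4 * real (Suc n) * (real (2 * Suc n choose Suc n))\<^sup>2" for n
  proof (induction n)
    case 0
    then show ?case by simp
  next
    case (Suc n)
    let ?k = "real (Suc n)"
    define c where "c = real (2 * Suc n choose Suc n)"
    define c' where "c' = real (2 * Suc (Suc n) choose Suc (Suc n))"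
    have r: "(?k + 1) * c' = 2 * (2 * ?k + 1) * c"
    proof -
      have "Suc (Suc n) * (2 * Suc (Suc n) choose Suc (Suc n)) = 2 * Suc (2 * Suc n) * (2 * Suc n choose Suc n)"
      proof -
        have "Suc (Suc n) * (Suc (Suc (2 * Suc n)) choose Suc (Suc n)) = Suc (Suc (2 * Suc n)) * (Suc (2 * Suc n) choose Suc n)"
          by (metis Suc_times_binomial_eq mult.commute)
        moreover have "Suc (Suc n) * (Suc (2 * Suc n) choose Suc n) = Suc (2 * Suc n) * (2 * Suc n choose Suc n)"
          using binomial_absorb_comp[of "Suc (2 * Suc n)" "Suc n"] by (simp del: binomial_Suc_Suc add: numeral_2_eq_2)
        moreover have "Suc (Suc (2 * Suc n)) = 2 * Suc (Suc n)" by simp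
        ultimately show ?thesis by (metis mult.assoc)
      qed
      then have "real (Suc (Suc n)) * c' = 2 * real (Suc (2 * Suc n)) * c"
        unfolding c_def c'_def by (metis of_nat_mult of_nat_numeral)
      then show ?thesis by simp
    qed
    have "16 ^ Suc (Suc n) \<le> 16 * (4 * ?k * c\<^sup>2)" using Suc unfolding c_def by simp
    \<comment> \<open>The added term completes the square in the ratio:
      \<open>4 * k * (k + 1) + 1 = (2 * k + 1)^2\<close>.\<close>
    also have "\<dots> \<le> 16 * (4 * ?k * c\<^sup>2) + 16 * c\<^sup>2 / (?k + 1)" by simp
    also have "\<dots> = 4 * (2 * (2 * ?k + 1) * c)\<^sup>2 / (?k + 1)"
      by (simp add: divide_simps power2_eq_square) (simp add: algebra_simps)
    also have "\<dots> = 4 * (?k + 1) * c'\<^sup>2"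
      unfolding r[symmetric] by (simp add: power2_eq_square)
    finally show ?case by (simp add: c'_def add.commute)
  qed
  obtain n where n: "k = Suc n" using assms by (cases k) auto
  have "(4 ^ k)\<^sup>2 = ((4::real)\<^sup>2) ^ k"
    by (simp only: power_mult[symmetric] mult.commute)
  also have "\<dots> = 16 ^ k" by simp
  also have "\<dots> \<le> (2 * sqrt (real k) * real (2 * k choose k))\<^sup>2"
    using *[of n] unfolding n power_mult_distrib by (simp only: real_sqrt_pow2 of_nat_0_le_iff) simp
  finally have "(4 ^ k)\<^sup>2 \<le> (2 * sqrt (real k) * real (2 * k choose k))\<^sup>2" .
  then show ?thesis by (rule power2_le_imp_le) simp
qed

text \<open>The right side is what the derivative in \<open>below_prob_half_ge\<close> leaves after
  the scaling \<open>v = 2 * u\<close>. It is multiplied by \<open>1 + (2 * k - 1) * v\<close>,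
  which is at most \<open>2 * sqrt k\<close>; Bernoulli's inequality then controls both
  powers.\<close>

lemma bernoulli_product_bound:
  fixes v :: real
  assumes v: "0 \<le> v" and k: "0 < k" and kv: "real k * v\<^sup>2 \<le> 1 / 4"
  shows "sqrt (real k) * v / 2 \<le> (1 - v\<^sup>2) ^ (k - 1) * (1 + v) - (1 - v) ^ (2 * k - 1)"
proof -
  let ?k = "real k"
  have k1: "1 \<le> ?k" using k by simp
  have kv1: "1 * v\<^sup>2 \<le> ?k * v\<^sup>2" using k1 by (intro mult_right_mono) auto
  then have "v\<^sup>2 \<le> (1 / 2)\<^sup>2" using kv by (simp add: power2_eq_square)
  then have v2: "v \<le> 1 / 2" by (rule power2_le_imp_le) simp
  have w0: "0 < 1 + 2 * ?k * v" using v k1 by (simp add: add_pos_nonneg)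
  define n where "n = 2 * k - 1"
  have n: "real n = 2 * ?k - 1" using k by (simp add: n_def of_nat_diff)
  define m where "m = (?k - 1) * v\<^sup>2"
  have m: "0 \<le> m" "m \<le> 1 / 4" using kv kv1 zero_le_power2[of v] unfolding m_def left_diff_distrib by linarith+
  have "1 + real (k - 1) * (- v\<^sup>2) \<le> (1 + - v\<^sup>2) ^ (k - 1)"
    using v v2 by (intro Bernoulli_inequality) (simp add: power_le_one)
  then have A: "1 - m \<le> (1 - v\<^sup>2) ^ (k - 1)" using k by (simp add: m_def of_nat_diff)
  have n0: "0 \<le> (2 * ?k - 1) * v" using v k1 by simp
  \<comment> \<open>Bernoulli's inequality puts \<open>(1 + v) ^ n\<close> above the linear factor,
    and \<open>(1 - v) * (1 + v) \<le> 1\<close>.\<close>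
  have B: "(1 - v) ^ n * (1 + (2 * ?k - 1) * v) \<le> 1"
  proof -
    have "(1 - v) ^ n * (1 + (2 * ?k - 1) * v) \<le> (1 - v) ^ n * (1 + v) ^ n"
      using Bernoulli_inequality[of v n] v v2 by (intro mult_left_mono) (auto simp: n)
    also have "\<dots> = (1 - v\<^sup>2) ^ n"
      by (simp add: power_mult_distrib[symmetric] power2_eq_square algebra_simps)
    also have "\<dots> \<le> 1" using v v2 by (intro power_le_one) (auto simp: power_le_one)
    finally show ?thesis .
  qed
  let ?N = "1 + (2 * ?k - 1) * v"
  have N: "0 < ?N" using n0 by linarith
  define b where "b = (1 - v\<^sup>2) ^ (k - 1) * (1 + v) - (1 - v) ^ n"
  \<comment> \<open>The margin splits into \<open>k * v * (1/2 - 2 * m)\<close> and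
    \<open>k * v / 2 - m\<close>, both nonnegative.\<close>
  have "?k * v \<le> (1 - m) * (1 + 2 * ?k * v) - 1"
  proof -
    have "0 \<le> ?k * v * (1 / 2 - 2 * m)" using v k1 m by (intro mult_nonneg_nonneg) auto
    moreover have "m \<le> ?k * v * (1 / 2)"
    proof -
      have "m \<le> ?k * v * v" using v by (simp add: m_def power2_eq_square algebra_simps)
      also have "\<dots> \<le> ?k * v * (1 / 2)" using v v2 by (intro mult_left_mono) auto
      finally show ?thesis .
    qed
    ultimately show ?thesis by (simp add: algebra_simps)
  qed
  also have "(1 - m) * (1 + 2 * ?k * v) - 1 \<le> (1 - m) * ((1 + v) * ?N) - 1"
    using m mult_nonneg_nonneg[OF v n0]
    by (intro diff_right_mono mult_left_mono) (simp_all add: algebra_simps)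
  also have "\<dots> \<le> (1 - v\<^sup>2) ^ (k - 1) * ((1 + v) * ?N) - (1 - v) ^ n * ?N"
    using A B v N by (intro diff_mono mult_right_mono) auto
  also have "\<dots> = b * ?N" by (simp add: b_def algebra_simps)
  finally have 1: "?k * v \<le> b * ?N" .
  have "0 \<le> b * ?N" by (rule order_trans[OF _ 1]) (use v in simp)
  then have b: "0 \<le> b" using N by (simp add: zero_le_mult_iff)
  let ?r = "sqrt ?k"
  have r: "1 \<le> ?r" using k1 by simp
  have rr: "?r * ?r = ?k" by simp
  have "(?r * v)\<^sup>2 \<le> (1 / 2)\<^sup>2" using kv by (simp add: power_mult_distrib power_divide)
  then have rv: "?r * v \<le> 1 / 2" by (rule power2_le_imp_le) simp
  \<comment> \<open>From \<open>k * v^2 \<le> 1/4\<close> follows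
    \<open>k * v \<le> sqrt k / 2\<close>, hence \<open>?N \<le> 1 + sqrt k\<close>.\<close>
  have "?N \<le> 2 * ?r"
  proof -
    have "?k * v = ?r * (?r * v)" by (simp only: rr mult.assoc[symmetric])
    also have "\<dots> \<le> ?r * (1 / 2)" using rv by (rule mult_left_mono) simp
    finally have "?k * v \<le> ?r / 2" by simp
    moreover have "?N = 1 + 2 * (?k * v) - v" by (simp add: algebra_simps)
    ultimately show ?thesis using r v by linarith
  qed
  then have "b * ?N \<le> b * (2 * ?r)" using b by (rule mult_left_mono)
  with 1 have "?k * v \<le> b * (2 * ?r)" by (rule order_trans)
  then have "?r * (?r * v) \<le> b * (2 * ?r)" by (simp only: rr mult.assoc[symmetric])
  then have "?r * (?r * v) \<le> ?r * (b * 2)" by (simp add: mult_ac)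
  then have "?r * v \<le> b * 2" using r by (subst (asm) mult_le_cancel_left_pos) auto
  then show ?thesis by (simp add: b_def n_def)
qed

text \<open>With \<open>2 * k\<close> trials and both thresholds \<open>k\<close>, the closed form
  applies with its correction term. Its derivative in the gap \<open>u\<close> is at least
  \<open>2 * k * u\<close>, the derivative of \<open>k * u^2\<close>, and at gap 0 its value is
  nonnegative.\<close>

lemma below_prob_half_ge:
  assumes k: "0 < k" and x: "0 \<le> x" "16 * real k * x\<^sup>2 \<le> 1"
  shows "real k * x\<^sup>2 \<le> below_prob (1/2 - x) (1/2 - x) (2 * k) k k"
proof -
  let ?c = "real (2 * k choose k)"
  obtain j where j: "k = Suc j" using k by (cases k) auto
  let ?A = "real (Suc (Suc (2 * j)))"
  define G where "G u = 2 * binomial_cdf (1/2 - u) (2 * k) k - 1 + ?c * (1/2 - u) ^ (2 * k)" for u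
  have G: "below_prob (1/2 - u) (1/2 - u) (2 * k) k k = G u" for u
    using below_prob_eq[of "2 * k" k k "1/2 - u" "1/2 - u"] power_add[of "1/2 - u" k k]
    by (simp add: G_def mult_2[symmetric] mult.assoc)
  \<comment> \<open>\<open>?A\<close> is \<open>2 * k\<close>; absorption produces the central
    coefficient, so both parts of the derivative share a factor.\<close>
  have c: "2 * (?A * real (Suc (2 * j) choose j)) = 2 * real k * ?c"
  proof -
    have "Suc (Suc (2 * j)) * (Suc (2 * j) choose j) = Suc j * (Suc (Suc (2 * j)) choose Suc j)"
      by (metis Suc_times_binomial_eq mult.commute)
    then have "Suc (Suc (2 * j)) * (Suc (2 * j) choose j) = k * (2 * k choose k)"
      by (simp only: j) simp
    then show ?thesis by (metis mult.assoc of_nat_mult)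
  qed
  have deriv: "(G has_real_derivative 2 * real k * ?c *
      ((1/2 - u) ^ j * (1/2 + u) ^ k - (1/2 - u) ^ (2 * k - 1))) (at u)" for u
  proof -
    have inner: "((\<lambda>u::real. 1/2 - u) has_real_derivative -1) (at u)"
      by (auto intro!: derivative_eq_intros)
    have *: "((\<lambda>u. binomial_cdf (1/2 - u) (2 * k) k) has_real_derivative
       (- ?A * real (Suc (2 * j) choose j) * (1/2 - u) ^ j * (1 - (1/2 - u)) ^ (Suc (2 * j) - j)) * -1) (at u)"
      using DERIV_chain2[OF binomial_cdf_has_derivative inner, of "Suc (2 * j)" j] j by simp
    have p: "Suc (2 * j) - j = k" "1 - (1/2 - u) = 1/2 + u" using j by auto
    have "(G has_real_derivative 2 * ((- ?A * real (Suc (2 * j) choose j) * (1/2 - u) ^ j * (1 - (1/2 - u)) ^ (Suc (2 * j) - j)) * -1)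
        + ?c * (real (2 * k) * (-1 * (1/2 - u) ^ (2 * k - Suc 0)))) (at u)"
      unfolding G_def[abs_def]
      by (rule DERIV_add DERIV_diff[OF _ DERIV_const, simplified] DERIV_cmult DERIV_power * inner)+
    then have "(G has_real_derivative (2 * (?A * real (Suc (2 * j) choose j))) * ((1/2 - u) ^ j * (1/2 + u) ^ k)
        - 2 * real k * ?c * (1/2 - u) ^ (2 * k - 1)) (at u)"
      unfolding p by (rule DERIV_cong) (simp del: of_nat_Suc)
    then show ?thesis unfolding c by (simp only: right_diff_distrib)
  qed
  have ge: "2 * real k * u \<le> 2 * real k * ?c *
      ((1/2 - u) ^ j * (1/2 + u) ^ k - (1/2 - u) ^ (2 * k - 1))" if u: "0 \<le> u" "u \<le> x" for u
  proof -
    define v where "v = 2 * u"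
    have "real k * v\<^sup>2 \<le> real k * (2 * x)\<^sup>2"
      using u by (intro mult_left_mono power_mono) (auto simp: v_def)
    then have kv: "real k * v\<^sup>2 \<le> 1 / 4" using x by (simp add: power_mult_distrib)
    have b: "sqrt (real k) * v / 2 \<le> (1 - v\<^sup>2) ^ j * (1 + v) - (1 - v) ^ (2 * k - 1)"
      using bernoulli_product_bound[of v k] kv k u by (simp add: v_def j)
    have e: "(1/2 - u) ^ j * (1/2 + u) ^ k - (1/2 - u) ^ (2 * k - 1) =
       2 / 4 ^ k * ((1 - v\<^sup>2) ^ j * (1 + v) - (1 - v) ^ (2 * k - 1))"
    proof -
      have h: "1/2 - u = (1 - v) / 2" "1/2 + u = (1 + v) / 2" by (auto simp: v_def field_simps)
      have v: "1 - v\<^sup>2 = (1 - v) * (1 + v)" by (simp add: power2_eq_square algebra_simps)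
      have t: "(2::real) ^ (2 * k - 1) = 4 ^ k / 2" "(2::real) ^ j * 2 ^ k = 4 ^ k / 2"
        using j by (simp_all add: power_mult power_mult_distrib[symmetric])
      show ?thesis unfolding h v power_divide t power_mult_distrib
        using t(2) by (simp add: j field_simps)
    qed
    \<comment> \<open>The bounds \<open>4 ^ k / (2 * sqrt k)\<close> for the central coefficient and
      \<open>sqrt k * v / 2\<close> for the bracket multiply so that the roots cancel.\<close>
    have "2 * real k * u = 4 * real k * (1 / (2 * sqrt (real k))) * (sqrt (real k) * v / 2)"
      using k by (simp add: v_def)
    also have "\<dots> \<le> 4 * real k * (?c / 4 ^ k) * (sqrt (real k) * v / 2)"
      using central_binomial_ge[OF k] k u
      by (intro mult_right_mono mult_left_mono) (auto simp: v_def field_simps)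
    also have "\<dots> \<le> 4 * real k * (?c / 4 ^ k) * ((1 - v\<^sup>2) ^ j * (1 + v) - (1 - v) ^ (2 * k - 1))"
      using b by (intro mult_left_mono) auto
    also have "\<dots> = 2 * real k * ?c * ((1/2 - u) ^ j * (1/2 + u) ^ k - (1/2 - u) ^ (2 * k - 1))"
      unfolding e by simp
    finally show ?thesis .
  qed
  have "G 0 - real k * 0\<^sup>2 \<le> G x - real k * x\<^sup>2"
  proof (rule DERIV_nonneg_imp_nondecreasing[of 0 x "\<lambda>u. G u - real k * u\<^sup>2"])
    fix u assume "0 \<le> u" "u \<le> x"
    with ge deriv show "\<exists>y. ((\<lambda>u. G u - real k * u\<^sup>2) has_real_derivative y) (at u) \<and> 0 \<le> y"
      by (intro exI[of _ "2 * real k * ?c *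
        ((1/2 - u) ^ j * (1/2 + u) ^ k - (1/2 - u) ^ (2 * k - 1)) - 2 * real k * u"] conjI)
        (auto intro!: derivative_eq_intros simp del: of_nat_mult)
  qed (use x in simp)
  moreover have "0 \<le> G 0" using below_prob_nonneg[of "1/2" "1/2" "2 * k" k k] G[of 0] by simp
  ultimately show ?thesis by (simp add: G)
qed

section \<open>Transfer to independent samples\<close>

lemma prob_counts_below:
  assumes "prob_space D" and A: "A \<in> sets D" and B: "B \<in> sets D" and AB: "A \<inter> B = {}"
  shows "emeasure (\<Pi>\<^sub>M j\<in>{..<s}. D) {w \<in> space (\<Pi>\<^sub>M j\<in>{..<s}. D).
      card {j. j < s \<and> w j \<in> A} < a \<and> card {j. j < s \<and> w j \<in> B} < b}
    = ennreal (below_prob (measure D A) (measure D B) s a b)"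
proof -
  interpret D: prob_space D by fact
  interpret product_prob_space "\<lambda>_. D" by standard
  note A[measurable] B[measurable]
  let ?p = "D.prob A" and ?q = "D.prob B"
  have pq: "?p + ?q \<le> 1" using D.finite_measure_Union[OF A B AB] D.prob_le_1[of "A \<union> B"] by simp
  \<comment> \<open>Counts as sums of 0/1 values give measurability and split off the last
    sample.\<close>
  have card_sum: "card {j. j < s \<and> w j \<in> S} = (\<Sum>j<s. if w j \<in> S then 1 else 0)" for s :: nat and w :: "nat \<Rightarrow> 'a" and S
    by (simp add: sum.If_cases Int_def)
  define E where "E s a b = {w \<in> space (\<Pi>\<^sub>M j\<in>{..<s}. D).
      (\<Sum>j<s. if w j \<in> A then 1 else 0) < a \<and> (\<Sum>j<s. if w j \<in> B then 1 else 0) < b}" for s :: nat and a b :: nat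
  have E[measurable]: "E s a b \<in> sets (\<Pi>\<^sub>M j\<in>{..<s}. D)" for s a b
    unfolding E_def by measurable
  have "emeasure (\<Pi>\<^sub>M j\<in>{..<s}. D) (E s a b) = ennreal (below_prob ?p ?q s a b)"
  proof (induction s arbitrary: a b)
    case 0
    then show ?case by (simp add: E_def PiM_empty)
  next
    case (Suc s)
    show ?case
    proof (cases "0 < a \<and> 0 < b")
      case False
      then have "E (Suc s) a b = {}" by (auto simp: E_def)
      then show ?thesis using False by auto
    next
      case True
      let ?g = "below_prob ?p ?q s"
      have g: "0 \<le> ?g a b" for a b using pq by (intro below_prob_nonneg) auto
      have S: "{..<Suc s} = insert s {..<s}" by auto
      have "emeasure (\<Pi>\<^sub>M j\<in>{..<Suc s}. D) (E (Suc s) a b) =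
          (\<integral>\<^sup>+ w. indicator (E (Suc s) a b) w \<partial>(\<Pi>\<^sub>M j\<in>insert s {..<s}. D))"
        using E[of "Suc s" a b] by (simp add: S)
      \<comment> \<open>Fixing the last sample \<open>y\<close> is the one-trial step of
        \<open>below_prob\<close>: a hit in \<open>A\<close> or \<open>B\<close> lowers the matching
        threshold by one.\<close>
      also have "\<dots> = (\<integral>\<^sup>+ y. (\<integral>\<^sup>+ w. indicator (E (Suc s) a b) (w(s := y)) \<partial>(\<Pi>\<^sub>M j\<in>{..<s}. D)) \<partial>D)"
        using E[of "Suc s" a b] by (intro product_nn_integral_insert_rev) (auto simp: S)
      also have "\<dots> = (\<integral>\<^sup>+ y. ennreal (?g (a - 1) b) * indicator A y + ennreal (?g a (b - 1)) * indicator B y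
          + ennreal (?g a b) * indicator (space D - (A \<union> B)) y \<partial>D)"
      proof (rule nn_integral_cong)
        fix y assume y: "y \<in> space D"
        have "(\<integral>\<^sup>+ w. indicator (E (Suc s) a b) (w(s := y)) \<partial>(\<Pi>\<^sub>M j\<in>{..<s}. D)) =
          (\<integral>\<^sup>+ w. indicator (E s (a - (if y \<in> A then 1 else 0)) (b - (if y \<in> B then 1 else 0))) w \<partial>(\<Pi>\<^sub>M j\<in>{..<s}. D))"
        proof (rule nn_integral_cong)
          fix w assume w: "w \<in> space (\<Pi>\<^sub>M j\<in>{..<s}. D)"
          then have "w(s := y) \<in> space (\<Pi>\<^sub>M j\<in>{..<Suc s}. D)"
            using y by (auto simp: space_PiM S intro!: PiE_fun_upd)
          moreover have "(\<Sum>j<s. if (w(s := y)) j \<in> Z then 1 else 0) = (\<Sum>j<s. if w j \<in> Z then 1 else (0::nat))" for Z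
            by (intro sum.cong) auto
          ultimately have "w(s := y) \<in> E (Suc s) a b \<longleftrightarrow>
              w \<in> E s (a - (if y \<in> A then 1 else 0)) (b - (if y \<in> B then 1 else 0))"
            using w by (auto simp: E_def)
          then show "indicator (E (Suc s) a b) (w(s := y)) =
              (indicator (E s (a - (if y \<in> A then 1 else 0)) (b - (if y \<in> B then 1 else 0))) w :: ennreal)"
            by (simp add: indicator_def)
        qed
        also have "\<dots> = ennreal (?g (a - (if y \<in> A then 1 else 0)) (b - (if y \<in> B then 1 else 0)))"
          using E by (simp add: Suc.IH)
        also have "\<dots> = ennreal (?g (a - 1) b) * indicator A y + ennreal (?g a (b - 1)) * indicator B y
          + ennreal (?g a b) * indicator (space D - (A \<union> B)) y"
          using AB y by (auto simp: indicator_def)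
        finally show "(\<integral>\<^sup>+ w. indicator (E (Suc s) a b) (w(s := y)) \<partial>(\<Pi>\<^sub>M j\<in>{..<s}. D)) = \<dots>" .
      qed
      also have "\<dots> = ennreal (?g (a - 1) b) * ennreal ?p + ennreal (?g a (b - 1)) * ennreal ?q
          + ennreal (?g a b) * ennreal (D.prob (space D - (A \<union> B)))"
        by (simp add: nn_integral_add nn_integral_cmult D.emeasure_eq_measure)
      also have "D.prob (space D - (A \<union> B)) = 1 - ?p - ?q"
        using D.finite_measure_Union[OF A B AB] by (subst D.prob_compl) auto
      also have "ennreal (?g (a - 1) b) * ennreal ?p + ennreal (?g a (b - 1)) * ennreal ?q
          + ennreal (?g a b) * ennreal (1 - ?p - ?q) = ennreal (below_prob ?p ?q (Suc s) a b)"
        using True g pq by (simp flip: ennreal_mult' ennreal_plus add: mult.commute)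
      finally show ?thesis .
    qed
  qed
  then show ?thesis unfolding E_def card_sum .
qed

lemma prob_counts_below_half_ge:
  assumes D: "prob_space D" and A: "A \<in> sets D" and B: "B \<in> sets D" and AB: "A \<inter> B = {}"
    and x: "0 \<le> x" "16 * real s * x\<^sup>2 \<le> 1"
    and p: "measure D A \<le> 1/2 - x" and q: "measure D B \<le> 1/2 - x" and s: "0 < s"
  shows "real s * x\<^sup>2 / 2 \<le> measure (\<Pi>\<^sub>M j\<in>{..<s}. D) {w \<in> space (\<Pi>\<^sub>M j\<in>{..<s}. D).
      2 * card {j. j < s \<and> w j \<in> A} < s \<and> 2 * card {j. j < s \<and> w j \<in> B} < s}"
proof -
  \<comment> \<open>Half of \<open>s\<close> rounded up, so that \<open>2 * n < s\<close> means
    \<open>n < k\<close>. For odd \<open>s\<close> the bound is derived for \<open>s + 1\<close>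
    trials, and dropping one can only raise the probability.\<close>
  define k where "k = (s + 1) div 2"
  have k: "0 < k" "k \<le> s" "s \<le> 2 * k" "2 * k \<le> Suc s" "2 * n < s \<longleftrightarrow> n < k" for n
    using s by (auto simp: k_def)
  let ?p = "measure D A" and ?q = "measure D B"
  have pq: "0 \<le> ?p" "0 \<le> ?q" "?p + ?q \<le> 1" using p q x by auto
  have "real s * x\<^sup>2 / 2 \<le> real k * x\<^sup>2"
    using k(3) mult_right_mono[of "real s" "real (2 * k)" "x\<^sup>2"] by simp
  also have "\<dots> \<le> below_prob (1/2 - x) (1/2 - x) (2 * k) k k"
  proof (rule below_prob_half_ge)
    have "16 * real k * x\<^sup>2 \<le> 16 * real s * x\<^sup>2" using k(2) by (intro mult_right_mono) auto
    then show "16 * real k * x\<^sup>2 \<le> 1" using x by simp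
  qed (use k x in auto)
  also have "\<dots> \<le> below_prob ?p ?q (2 * k) k k"
    using p q x by (intro below_prob_antimono) auto
  also have "\<dots> \<le> below_prob ?p ?q s k k"
  proof -
    have "2 * k = s \<or> 2 * k = Suc s" using k(3,4) by linarith
    then show ?thesis using below_prob_Suc_le[OF pq, of s k k] by (auto simp del: below_prob.simps)
  qed
  also have "\<dots> = measure (\<Pi>\<^sub>M j\<in>{..<s}. D) {w \<in> space (\<Pi>\<^sub>M j\<in>{..<s}. D).
      2 * card {j. j < s \<and> w j \<in> A} < s \<and> 2 * card {j. j < s \<and> w j \<in> B} < s}"
    unfolding k(5) using prob_counts_below[OF D A B AB, of s k k]
    by (simp add: measure_def[of "Pi\<^sub>M _ _"] below_prob_nonneg[OF pq])
  finally show ?thesis .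
qed

subsection \<open>Uniform deviation of the empirical loss\<close>

text \<open>Independence factorises the moment over the samples; Hoeffding's lemma at
  \<open>\<theta> / s\<close> bounds each of the \<open>s\<close> factors.\<close>

lemma nn_integral_exp_empirical_mean:
  fixes f :: "'c \<Rightarrow> real"
  assumes D: "prob_space D" and f[measurable]: "f \<in> borel_measurable D"
    and f01: "\<And>c. c \<in> space D \<Longrightarrow> 0 \<le> f c \<and> f c \<le> 1" and s: "0 < s" and \<theta>: "0 < \<theta>"
  shows "(\<integral>\<^sup>+ w. ennreal (exp (\<theta> * ((\<Sum>j<s. f (w j)) / real s - (LINT c|D. f c)))) \<partial>(\<Pi>\<^sub>M j\<in>{..<s}. D))
    \<le> ennreal (exp (\<theta>\<^sup>2 / (8 * real s)))"
proof -
  interpret D: prob_space D by fact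
  interpret product_prob_space "\<lambda>_. D" by standard
  let ?l = "\<theta> / real s"
  let ?\<mu> = "LINT c|D. f c"
  interpret Hoeff: interval_bounded_random_variable D f 0 1
    by unfold_locales (use f01 in auto)
  have e: "exp (\<theta> * ((\<Sum>j<s. f (w j)) / real s - ?\<mu>)) = (\<Prod>j<s. exp (?l * (f (w j) - ?\<mu>)))" for w
  proof -
    have "(\<Sum>j<s. ?l * (f (w j) - ?\<mu>)) = ?l * ((\<Sum>j<s. f (w j)) - real s * ?\<mu>)"
      by (simp only: sum_distrib_left[symmetric] sum_subtractf sum_constant card_lessThan)
    also have "\<dots> = \<theta> * ((\<Sum>j<s. f (w j)) / real s - ?\<mu>)" using s by (simp add: field_simps)
    finally show ?thesis by (simp only: exp_sum[symmetric] finite_lessThan)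
  qed
  have "(\<integral>\<^sup>+ w. ennreal (exp (\<theta> * ((\<Sum>j<s. f (w j)) / real s - ?\<mu>))) \<partial>(\<Pi>\<^sub>M j\<in>{..<s}. D))
      = (\<integral>\<^sup>+ w. (\<Prod>j<s. ennreal (exp (?l * (f (w j) - ?\<mu>)))) \<partial>(\<Pi>\<^sub>M j\<in>{..<s}. D))"
    unfolding e by (simp add: prod_ennreal)
  also have "\<dots> = (\<Prod>j<s. \<integral>\<^sup>+ c. ennreal (exp (?l * (f c - ?\<mu>))) \<partial>D)"
    by (subst product_nn_integral_prod) auto
  also have "\<dots> \<le> (\<Prod>j<s. ennreal (exp (?l\<^sup>2 * (1 - 0)\<^sup>2 / 8)))"
    using \<theta> s by (intro prod_mono_ennreal Hoeff.Hoeffdings_lemma_nn_integral) auto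
  also have "\<dots> = ennreal (exp (\<theta>\<^sup>2 / (8 * real s)))"
    using s by (simp add: ennreal_power exp_of_nat_mult[symmetric] power2_eq_square field_simps)
  finally show ?thesis .
qed

text \<open>Chernoff's method applied to the \<open>L\<^sup>1\<close> distance of the empirical and the true mean
  as a whole: Jensen's inequality over \<open>Q\<close> reduces its exponential moment to those of the
  individual deviations, so neither a covering argument nor a union bound is needed.\<close>

lemma prob_L1_deviation_ge:
  fixes g :: "'t \<Rightarrow> 'c \<Rightarrow> real"
  assumes D: "prob_space D" and Q: "prob_space Q"
    and g: "(\<lambda>(t, c). g t c) \<in> borel_measurable (Q \<Otimes>\<^sub>M D)"
    and g01: "\<And>t c. 0 \<le> g t c \<and> g t c \<le> 1" and s: "0 < s" and l: "0 < l"
  defines "G \<equiv> \<lambda>w t. (\<Sum>j<s. g t (w j)) / real s - (LINT c|D. g t c)"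
  shows "(\<lambda>w. LINT t|Q. \<bar>G w t\<bar>) \<in> borel_measurable (\<Pi>\<^sub>M j\<in>{..<s}. D)" (is ?Meas)
    and "measure (\<Pi>\<^sub>M j\<in>{..<s}. D) {w \<in> space (\<Pi>\<^sub>M j\<in>{..<s}. D). l \<le> (LINT t|Q. \<bar>G w t\<bar>)}
      \<le> 2 * exp (- 2 * real s * l\<^sup>2)" (is ?Tail)
    and "w \<in> space (\<Pi>\<^sub>M j\<in>{..<s}. D) \<Longrightarrow> integrable Q (G w)"
proof -
  interpret D: prob_space D by fact
  interpret Q: prob_space Q by fact
  let ?P = "\<Pi>\<^sub>M j\<in>{..<s}. D"
  interpret P: prob_space ?P by (rule prob_space_PiM) (rule D)
  interpret PQ: pair_prob_space ?P Q ..
  have g1[measurable]: "g t \<in> borel_measurable D" if "t \<in> space Q" for t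
    using measurable_compose[OF measurable_Pair1'[OF that] g] by simp
  have gj[measurable]: "(\<lambda>x. g (snd x) (fst x j)) \<in> borel_measurable (?P \<Otimes>\<^sub>M Q)" if "j < s" for j
  proof -
    have "(\<lambda>x. (snd x, fst x j)) \<in> ?P \<Otimes>\<^sub>M Q \<rightarrow>\<^sub>M Q \<Otimes>\<^sub>M D"
      using that by (intro measurable_Pair measurable_compose[OF measurable_fst] measurable_snd) simp
    from measurable_compose[OF this g] show ?thesis by simp
  qed
  have mu[measurable]: "(\<lambda>t. LINT c|D. g t c) \<in> borel_measurable Q"
    using g by (rule D.borel_measurable_lebesgue_integral)
  have G[measurable]: "(\<lambda>(w, t). G w t) \<in> borel_measurable (?P \<Otimes>\<^sub>M Q)"
    unfolding G_def split_beta' by (intro borel_measurable_diff borel_measurable_divide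
      borel_measurable_sum gj measurable_compose[OF measurable_snd mu]) auto
  have Gw[measurable]: "G w \<in> borel_measurable Q" if "w \<in> space ?P" for w
    using measurable_compose[OF measurable_Pair1'[OF that] G] by simp
  have Gt[measurable]: "(\<lambda>w. G w t) \<in> borel_measurable ?P" if "t \<in> space Q" for t
    using measurable_compose[OF measurable_Pair2'[OF that] G] by simp
  have Gb: "\<bar>G w t\<bar> \<le> 1" if "t \<in> space Q" for w t
  proof -
    have "integrable D (g t)"
      using g01 that by (intro D.integrable_const_bound[of _ 1]) auto
    then have "0 \<le> (LINT c|D. g t c)" "(LINT c|D. g t c) \<le> (LINT c|D. 1)"
      using g01 by (auto intro!: integral_nonneg integral_mono simp del: lebesgue_integral_const)
    moreover have "(\<Sum>j<s. g t (w j)) \<le> (\<Sum>j<s. 1)" "0 \<le> (\<Sum>j<s. g t (w j))"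
      using g01 by (auto intro!: sum_mono sum_nonneg simp del: sum_constant)
    moreover from this have "(\<Sum>j<s. g t (w j)) / real s \<le> 1" "0 \<le> (\<Sum>j<s. g t (w j)) / real s"
      using s by auto
    moreover have "(LINT c|D. 1 :: real) = 1" by (simp add: D.prob_space)
    ultimately show ?thesis unfolding G_def abs_le_iff by linarith
  qed
  show ?Meas by measurable
  show int: "integrable Q (G w)" if "w \<in> space ?P" for w
    using Gb that by (intro Q.integrable_const_bound[of _ 1]) auto
  \<comment> \<open>Minimises the Chernoff exponent
    \<open>\<theta>^2 / (8 * s) - \<theta> * l\<close>; the minimum is
    \<open>- 2 * s * l^2\<close>.\<close>
  define \<theta> where "\<theta> = 4 * real s * l"
  have \<theta>: "0 < \<theta>" using s l by (simp add: \<theta>_def)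
  have mom: "(\<integral>\<^sup>+ w. ennreal (exp (\<theta> * \<bar>G w t\<bar>)) \<partial>?P) \<le> ennreal (2 * exp (\<theta>\<^sup>2 / (8 * real s)))"
    if t: "t \<in> space Q" for t
  proof -
    have i: "integrable D (g t)"
      using g01 t by (intro D.integrable_const_bound[of _ 1]) auto
    \<comment> \<open>The lower tail is the upper tail for \<open>1 - g\<close>, again with values
      in \<open>[0, 1]\<close>.\<close>
    have neg: "- G w t = (\<Sum>j<s. 1 - g t (w j)) / real s - (LINT c|D. 1 - g t c)" for w
      using s i by (simp add: G_def sum_subtractf diff_divide_distrib D.prob_space)
    have "(\<integral>\<^sup>+ w. ennreal (exp (\<theta> * \<bar>G w t\<bar>)) \<partial>?P) \<le>
        (\<integral>\<^sup>+ w. ennreal (exp (\<theta> * G w t)) + ennreal (exp (\<theta> * (- G w t))) \<partial>?P)"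
      by (intro nn_integral_mono) (auto simp: abs_if simp flip: ennreal_plus)
    also have "\<dots> = (\<integral>\<^sup>+ w. ennreal (exp (\<theta> * G w t)) \<partial>?P) + (\<integral>\<^sup>+ w. ennreal (exp (\<theta> * (- G w t))) \<partial>?P)"
      using t by (intro nn_integral_add) measurable
    also have "\<dots> \<le> ennreal (exp (\<theta>\<^sup>2 / (8 * real s))) + ennreal (exp (\<theta>\<^sup>2 / (8 * real s)))"
    proof (rule add_mono)
      show "(\<integral>\<^sup>+ w. ennreal (exp (\<theta> * G w t)) \<partial>?P) \<le> ennreal (exp (\<theta>\<^sup>2 / (8 * real s)))"
        unfolding G_def using g01 s \<theta> t
        by (intro nn_integral_exp_empirical_mean[OF D]) auto
      show "(\<integral>\<^sup>+ w. ennreal (exp (\<theta> * (- G w t))) \<partial>?P) \<le> ennreal (exp (\<theta>\<^sup>2 / (8 * real s)))"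
        unfolding neg using g01 s \<theta> t
        by (intro nn_integral_exp_empirical_mean[OF D]) auto
    qed
    also have "\<dots> = ennreal (2 * exp (\<theta>\<^sup>2 / (8 * real s)))" by (simp flip: ennreal_plus)
    finally show ?thesis .
  qed
  let ?V = "\<lambda>w. LINT t|Q. \<bar>G w t\<bar>"
  have jensen: "ennreal (exp (\<theta> * ?V w)) \<le> (\<integral>\<^sup>+ t. ennreal (exp (\<theta> * \<bar>G w t\<bar>)) \<partial>Q)"
    if w: "w \<in> space ?P" for w
  proof -
    have iV: "integrable Q (\<lambda>t. \<bar>G w t\<bar>)" using int[OF w] by simp
    have ie: "integrable Q (\<lambda>t. exp (\<theta> * \<bar>G w t\<bar>))"
      using Gb w \<theta> by (intro Q.integrable_const_bound[of _ "exp \<theta>"]) (auto simp: mult_le_cancel_left1)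
    \<comment> \<open>Jensen's inequality through the tangent of the exponential at the mean
      \<open>?V w\<close>, whose linear part integrates to 0.\<close>
    have "exp (\<theta> * ?V w) = (LINT t|Q. exp (\<theta> * ?V w) * (1 + \<theta> * (\<bar>G w t\<bar> - ?V w)))"
      using iV by (simp add: Q.prob_space)
    also have "\<dots> \<le> (LINT t|Q. exp (\<theta> * \<bar>G w t\<bar>))"
    proof (rule integral_mono)
      fix t
      have "exp (\<theta> * ?V w) * (1 + \<theta> * (\<bar>G w t\<bar> - ?V w)) \<le> exp (\<theta> * ?V w) * exp (\<theta> * (\<bar>G w t\<bar> - ?V w))"
        by (intro mult_left_mono exp_ge_add_one_self) auto
      also have "\<dots> = exp (\<theta> * \<bar>G w t\<bar>)" by (simp add: exp_add[symmetric] algebra_simps)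
      finally show "exp (\<theta> * ?V w) * (1 + \<theta> * (\<bar>G w t\<bar> - ?V w)) \<le> exp (\<theta> * \<bar>G w t\<bar>)" .
    qed (use iV ie in auto)
    finally have "ennreal (exp (\<theta> * ?V w)) \<le> ennreal (LINT t|Q. exp (\<theta> * \<bar>G w t\<bar>))" by (rule ennreal_leI)
    also have "\<dots> = (\<integral>\<^sup>+ t. ennreal (exp (\<theta> * \<bar>G w t\<bar>)) \<partial>Q)"
      using ie by (intro nn_integral_eq_integral[symmetric]) auto
    finally show ?thesis .
  qed
  have VM[measurable]: ?Meas by measurable
  let ?B = "{w \<in> space ?P. l \<le> ?V w}"
  have B[measurable]: "?B \<in> sets ?P" by measurable
  \<comment> \<open>Markov's inequality; after Jensen the integrals are exchanged, so that
    \<open>mom\<close> applies for each \<open>t\<close> separately.\<close>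
  have "ennreal (exp (\<theta> * l)) * emeasure ?P ?B = (\<integral>\<^sup>+ w. ennreal (exp (\<theta> * l)) * indicator ?B w \<partial>?P)"
    by (rule nn_integral_cmult_indicator[symmetric]) fact
  also have "\<dots> \<le> (\<integral>\<^sup>+ w. ennreal (exp (\<theta> * ?V w)) \<partial>?P)"
    using \<theta> by (intro nn_integral_mono) (auto simp: indicator_def intro!: ennreal_leI)
  also have "\<dots> \<le> (\<integral>\<^sup>+ w. \<integral>\<^sup>+ t. ennreal (exp (\<theta> * \<bar>G w t\<bar>)) \<partial>Q \<partial>?P)"
    by (intro nn_integral_mono jensen)
  also have "\<dots> = (\<integral>\<^sup>+ t. \<integral>\<^sup>+ w. ennreal (exp (\<theta> * \<bar>G w t\<bar>)) \<partial>?P \<partial>Q)"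
    by (rule PQ.Fubini'[symmetric]) measurable
  also have "\<dots> \<le> (\<integral>\<^sup>+ t. ennreal (2 * exp (\<theta>\<^sup>2 / (8 * real s))) \<partial>Q)"
    by (intro nn_integral_mono mom)
  also have "\<dots> = ennreal (2 * exp (\<theta>\<^sup>2 / (8 * real s)))" by (simp add: Q.emeasure_space_1)
  finally have "ennreal (exp (\<theta> * l) * measure ?P ?B) \<le> ennreal (2 * exp (\<theta>\<^sup>2 / (8 * real s)))"
    by (simp add: P.emeasure_eq_measure ennreal_mult)
  then have "exp (\<theta> * l) * measure ?P ?B \<le> 2 * exp (\<theta>\<^sup>2 / (8 * real s))"
    by (simp add: ennreal_le_iff)
  then have "measure ?P ?B \<le> 2 * (exp (\<theta>\<^sup>2 / (8 * real s)) / exp (\<theta> * l))"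
    by (simp add: field_simps)
  also have "exp (\<theta>\<^sup>2 / (8 * real s)) / exp (\<theta> * l) = exp (- 2 * real s * l\<^sup>2)"
    using s by (simp add: exp_diff[symmetric] \<theta>_def power2_eq_square field_simps)
  finally show ?Tail .
qed

text \<open>The loss is affine in \<open>g\<close>: the \<open>\<eta>\<close> part cancels between
  empirical and expected loss, and \<open>\<sigma>\<close> only weights the deviation of
  \<open>g\<close>. In the application \<open>\<eta>\<close> and \<open>\<sigma>\<close> carry the
  hint; as they are absent from the bound, it is uniform over hints.\<close>

lemma empirical_loss_deviation_le:
  fixes g :: "'t \<Rightarrow> 'c \<Rightarrow> real"
  assumes D: "prob_space D" and Q: "prob_space Q"
    and g: "(\<lambda>(t, c). g t c) \<in> borel_measurable (Q \<Otimes>\<^sub>M D)"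
    and g01: "\<And>t c. 0 \<le> g t c \<and> g t c \<le> 1" and s: "0 < s" and K: "0 \<le> K"
    and \<eta>[measurable]: "\<eta> \<in> borel_measurable Q" and \<sigma>[measurable]: "\<sigma> \<in> borel_measurable Q"
    and b: "\<And>t. \<bar>\<eta> t\<bar> \<le> 1" "\<And>t. \<bar>\<sigma> t\<bar> \<le> 1"
    and loss: "\<And>c. c \<in> space D \<Longrightarrow> loss c = K * (LINT t|Q. \<eta> t + g t c * \<sigma> t)"
    and w: "w \<in> space (\<Pi>\<^sub>M j\<in>{..<s}. D)"
  shows "\<bar>(\<Sum>j<s. loss (w j)) / real s - (LINT c|D. loss c)\<bar>
    \<le> K * (LINT t|Q. \<bar>(\<Sum>j<s. g t (w j)) / real s - (LINT c|D. g t c)\<bar>)"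
proof -
  interpret D: prob_space D by fact
  interpret Q: prob_space Q by fact
  interpret QD: pair_prob_space Q D ..
  note g[measurable]
  let ?G = "\<lambda>t. (\<Sum>j<s. g t (w j)) / real s - (LINT c|D. g t c)"
  have wj: "w j \<in> space D" if "j < s" for j using w that by (auto simp: space_PiM)
  have g1[measurable]: "g t \<in> borel_measurable D" if "t \<in> space Q" for t
    using measurable_compose[OF measurable_Pair1'[OF that] g] by simp
  have g2[measurable]: "(\<lambda>t. g t c) \<in> borel_measurable Q" if "c \<in> space D" for c
    using measurable_compose[OF measurable_Pair2'[OF that] g] by simp
  have bd: "\<bar>g t c * \<sigma> t\<bar> \<le> 1" for t c
    using mult_mono[of "\<bar>g t c\<bar>" 1 "\<bar>\<sigma> t\<bar>" 1] g01[of t c] b(2)[of t] by (simp add: abs_mult)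
  have i\<eta>: "integrable Q \<eta>" using b by (intro Q.integrable_const_bound[of _ 1]) auto
  have ig: "integrable Q (\<lambda>t. g t c * \<sigma> t)" if "c \<in> space D" for c
    using bd that by (intro Q.integrable_const_bound[of _ 1]) auto
  have iD: "integrable D (g t)" if "t \<in> space Q" for t
    using g01 that by (intro D.integrable_const_bound[of _ 1]) auto
  have ip: "integrable (Q \<Otimes>\<^sub>M D) (\<lambda>(t, c). g t c * \<sigma> t)"
    using bd by (intro QD.P.integrable_const_bound[of _ 1]) (auto simp: split_beta')
  have i\<mu>: "integrable Q (\<lambda>t. (LINT c|D. g t c) * \<sigma> t)"
    using QD.integrable_fst[OF ip] by simp
  have iG: "integrable Q ?G"
    using prob_L1_deviation_ge(3)[OF D Q g g01 s zero_less_one w] .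
  have iG\<sigma>: "integrable Q (\<lambda>t. ?G t * \<sigma> t)"
  proof (rule Bochner_Integration.integrable_bound[OF iG])
    show "AE t in Q. norm (?G t * \<sigma> t) \<le> norm (?G t)"
      using b(2) by (intro AE_I2) (simp add: abs_mult mult_left_le)
  qed (use borel_measurable_integrable[OF iG] in measurable)
  have "(\<Sum>j<s. loss (w j)) / real s = K * ((\<Sum>j<s. (LINT t|Q. \<eta> t) + (LINT t|Q. g t (w j) * \<sigma> t)) / real s)"
    using wj ig i\<eta> by (simp add: loss sum_distrib_left)
  also have "(\<Sum>j<s. (LINT t|Q. \<eta> t) + (LINT t|Q. g t (w j) * \<sigma> t)) / real s =
      (LINT t|Q. \<eta> t) + (LINT t|Q. (\<Sum>j<s. g t (w j)) / real s * \<sigma> t)"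
  proof -
    have "(LINT t|Q. (\<Sum>j<s. g t (w j) * \<sigma> t)) = (\<Sum>j<s. (LINT t|Q. g t (w j) * \<sigma> t))"
      using wj ig by (intro Bochner_Integration.integral_sum) auto
    moreover have "(\<Sum>j<s. g t (w j)) / real s * \<sigma> t = (\<Sum>j<s. g t (w j) * \<sigma> t) / real s" for t
      by (simp add: sum_distrib_right)
    ultimately show ?thesis using s by (simp add: sum.distrib add_divide_distrib)
  qed
  finally have emp: "(\<Sum>j<s. loss (w j)) / real s = K * ((LINT t|Q. \<eta> t) + (LINT t|Q. (\<Sum>j<s. g t (w j)) / real s * \<sigma> t))" .
  have "(LINT c|D. loss c) = (LINT c|D. K * ((LINT t|Q. \<eta> t) + (LINT t|Q. g t c * \<sigma> t)))"
    using loss i\<eta> ig by (intro Bochner_Integration.integral_cong) auto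
  also have "\<dots> = K * ((LINT t|Q. \<eta> t) + (LINT c|D. LINT t|Q. g t c * \<sigma> t))"
    using QD.integrable_snd[OF ip] by (simp add: D.prob_space)
  also have "(LINT c|D. LINT t|Q. g t c * \<sigma> t) = (LINT t|Q. (LINT c|D. g t c) * \<sigma> t)"
    using QD.Fubini_integral[OF ip] by simp
  finally have "(\<Sum>j<s. loss (w j)) / real s - (LINT c|D. loss c) =
      K * ((LINT t|Q. (\<Sum>j<s. g t (w j)) / real s * \<sigma> t) - (LINT t|Q. (LINT c|D. g t c) * \<sigma> t))"
    unfolding emp by (simp add: algebra_simps)
  also have "(LINT t|Q. (\<Sum>j<s. g t (w j)) / real s * \<sigma> t) - (LINT t|Q. (LINT c|D. g t c) * \<sigma> t) = (LINT t|Q. ?G t * \<sigma> t)"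
  proof -
    have "integrable Q (\<lambda>t. ?G t * \<sigma> t + (LINT c|D. g t c) * \<sigma> t)" using iG\<sigma> i\<mu> by (rule Bochner_Integration.integrable_add)
    then have "integrable Q (\<lambda>t. (\<Sum>j<s. g t (w j)) / real s * \<sigma> t)" by (simp add: algebra_simps)
    from Bochner_Integration.integral_diff[OF this i\<mu>] show ?thesis by (simp add: algebra_simps)
  qed
  finally have "\<bar>(\<Sum>j<s. loss (w j)) / real s - (LINT c|D. loss c)\<bar> = K * \<bar>LINT t|Q. ?G t * \<sigma> t\<bar>"
    using K by (simp add: abs_mult)
  also have "\<dots> \<le> K * (LINT t|Q. \<bar>?G t\<bar>)"
  proof (intro mult_left_mono K)
    have "\<bar>LINT t|Q. ?G t * \<sigma> t\<bar> \<le> (LINT t|Q. \<bar>?G t * \<sigma> t\<bar>)" by (rule integral_abs_bound)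
    also have "\<dots> \<le> (LINT t|Q. \<bar>?G t\<bar>)"
      using integrable_abs[OF iG] integrable_abs[OF iG\<sigma>] b(2)
      by (intro integral_mono) (simp_all add: abs_mult mult_left_le)
    finally show "\<bar>LINT t|Q. ?G t * \<sigma> t\<bar> \<le> (LINT t|Q. \<bar>?G t\<bar>)" .
  qed
  finally show ?thesis .
qed

subsection \<open>Empirical medians\<close>

text \<open>Setting for dimension one, with \<open>X\<close> the only coordinate of the optimal
  hint.\<close>

locale bounded_sample = prob_space D for D :: "'c measure" +
  fixes X :: "'c \<Rightarrow> real" and M :: real
  assumes X [measurable]: "X \<in> borel_measurable D"
    and X_le: "\<And>c. c \<in> space D \<Longrightarrow> \<bar>X c\<bar> \<le> M"
begin

definition risk :: "real \<Rightarrow> real" where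
  "risk h = (LINT c|D. \<bar>X c - h\<bar>)"

lemma integrable_dist [simp]: "integrable D (\<lambda>c. \<bar>X c - h\<bar>)"
proof (rule integrable_const_bound[of _ "M + \<bar>h\<bar>"])
  have "\<bar>X c - h\<bar> \<le> M + \<bar>h\<bar>" if "c \<in> space D" for c
    using X_le[OF that] by linarith
  then show "AE c in D. norm \<bar>X c - h\<bar> \<le> M + \<bar>h\<bar>" by (intro AE_I2) simp
qed measurable

lemma risk_measurable [measurable]: "risk \<in> borel_measurable borel"
  unfolding risk_def by measurable

lemma risk_lipschitz: "risk t \<le> risk q + \<bar>t - q\<bar>"
proof -
  have "risk t \<le> (LINT c|D. \<bar>X c - q\<bar> + \<bar>t - q\<bar>)"
    unfolding risk_def by (intro integral_mono) auto
  also have "\<dots> = risk q + \<bar>t - q\<bar>" by (simp add: risk_def prob_space)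
  finally show ?thesis .
qed

text \<open>Convexity: \<open>t\<close> lies between \<open>h0\<close> and \<open>t'\<close>, so
  risk at most \<open>\<tau>\<close> at both ends would force it at \<open>t\<close>. The convex
  combination is cleared of the denominator \<open>t' - h0\<close>.\<close>

lemma risk_increasing_above:
  assumes "h0 < t" "t \<le> t'" "risk h0 \<le> \<tau>" "\<tau> < risk t"
  shows "\<tau> < risk t'"
proof (rule ccontr)
  assume "\<not> \<tau> < risk t'"
  have "(t' - h0) * \<bar>y - t\<bar> \<le> (t' - t) * \<bar>y - h0\<bar> + (t - h0) * \<bar>y - t'\<bar>" for y
  proof -
    have "(t' - h0) * \<bar>y - t\<bar> = \<bar>(t' - h0) * (y - t)\<bar>" using assms by (simp add: abs_mult)
    also have "(t' - h0) * (y - t) = (t' - t) * (y - h0) + (t - h0) * (y - t')"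
      by (simp add: algebra_simps)
    also have "\<bar>\<dots>\<bar> \<le> \<bar>(t' - t) * (y - h0)\<bar> + \<bar>(t - h0) * (y - t')\<bar>" by (rule abs_triangle_ineq)
    also have "\<dots> = (t' - t) * \<bar>y - h0\<bar> + (t - h0) * \<bar>y - t'\<bar>" using assms by (simp add: abs_mult)
    finally show ?thesis .
  qed
  then have "(LINT c|D. (t' - h0) * \<bar>X c - t\<bar>) \<le> (LINT c|D. (t' - t) * \<bar>X c - h0\<bar> + (t - h0) * \<bar>X c - t'\<bar>)"
    by (intro integral_mono) auto
  then have "(t' - h0) * risk t \<le> (t' - t) * risk h0 + (t - h0) * risk t'"
    by (simp add: risk_def)
  also have "\<dots> \<le> (t' - t) * \<tau> + (t - h0) * \<tau>"
    using assms \<open>\<not> \<tau> < risk t'\<close> by (intro add_mono mult_left_mono) auto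
  also have "\<dots> = (t' - h0) * \<tau>" by (simp add: algebra_simps)
  finally show False using assms by (simp add: mult_le_cancel_left_pos)
qed

text \<open>Let \<open>q\<close> be the infimum of the bad values above \<open>h0\<close>. Moving
  the hint from \<open>h0\<close> to \<open>q\<close> raises the risk by at least \<open>e\<close>,
  yet every value at or beyond \<open>q\<close> gets closer by \<open>q - h0\<close>, and the others
  recede by at most that. As \<open>q - h0 \<le> 2 * M\<close>, the former have probability below
  1/2 by the stated margin.\<close>

lemma prob_risk_large_above:
  assumes h0: "- M \<le> h0" and e: "0 < e" "e \<le> 2 * M" and \<tau>: "risk h0 + e \<le> \<tau>"
  shows "prob {c \<in> space D. h0 < X c \<and> \<tau> < risk (X c)} \<le> 1/2 - e / (4 * M)"
proof -
  define U where "U = {h. h0 < h \<and> h \<le> M \<and> \<tau> < risk h}"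
  have M: "0 < M" using e by simp
  have sub: "X c \<in> U" if "c \<in> space D" "h0 < X c" "\<tau> < risk (X c)" for c
    using that X_le[of c] by (auto simp: U_def)
  show ?thesis
  proof (cases "U = {}")
    \<comment> \<open>Without bad values the event is empty, and \<open>e \<le> 2 * M\<close> makes
      the bound nonnegative.\<close>
    case True
    then have *: "{c \<in> space D. h0 < X c \<and> \<tau> < risk (X c)} = {}" using sub by auto
    show ?thesis unfolding * using e M by (simp add: field_simps)
  next
    case False
    define q where "q = Inf U"
    have bdd: "bdd_below U" by (rule bdd_belowI[of _ h0]) (auto simp: U_def)
    have q: "q \<le> t" if "t \<in> U" for t using that bdd by (simp add: q_def cInf_lower)
    have h0q: "h0 \<le> q" unfolding q_def using False by (rule cInf_greatest) (auto simp: U_def)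
    have qM: "q \<le> M" using False q by (force simp: U_def)
    \<comment> \<open>The Lipschitz bound carries the threshold over to the infimum, which need not
      lie in \<open>U\<close>.\<close>
    have "\<tau> \<le> risk q"
    proof (rule field_le_epsilon)
      fix n :: real assume "0 < n"
      then obtain t where t: "t \<in> U" "t < q + n"
        using cInf_lessD[OF False, of "q + n"] by (auto simp: q_def)
      then show "\<tau> \<le> risk q + n" using q[of t] risk_lipschitz[of t q] by (auto simp: U_def)
    qed
    let ?Z = "{c \<in> space D. q \<le> X c}"
    have iZ: "integrable D (indicator ?Z :: _ \<Rightarrow> real)"
      by (intro integrable_real_indicator) (auto simp: emeasure_eq_measure)
    have EZ: "(LINT c|D. (1 - 2 * indicator ?Z c)) = 1 - 2 * prob ?Z"
      using iZ by (subst Bochner_Integration.integral_diff) (auto simp: prob_space)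
    have "e \<le> risk q - risk h0" using \<open>\<tau> \<le> risk q\<close> \<tau> by simp
    also have "\<dots> = (LINT c|D. \<bar>X c - q\<bar> - \<bar>X c - h0\<bar>)" by (simp add: risk_def)
    also have "\<dots> \<le> (LINT c|D. (q - h0) * (1 - 2 * indicator ?Z c))"
    proof (rule integral_mono)
      show "integrable D (\<lambda>c. (q - h0) * (1 - 2 * indicator ?Z c))"
        using iZ by (intro integrable_mult_right Bochner_Integration.integrable_diff integrable_const)
      show "\<bar>X c - q\<bar> - \<bar>X c - h0\<bar> \<le> (q - h0) * (1 - 2 * indicator ?Z c)" if "c \<in> space D" for c
        using h0q that by (cases "q \<le> X c") (auto simp: indicator_def)
    qed auto
    also have "\<dots> = (q - h0) * (1 - 2 * prob ?Z)" by (simp add: EZ)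
    finally have *: "e \<le> (q - h0) * (1 - 2 * prob ?Z)" .
    \<comment> \<open>This sign allows \<open>q - h0\<close> to be replaced by the larger
      \<open>2 * M\<close>.\<close>
    have "0 < 1 - 2 * prob ?Z"
    proof (rule ccontr)
      assume "\<not> 0 < 1 - 2 * prob ?Z"
      then have "(q - h0) * (1 - 2 * prob ?Z) \<le> 0" using h0q by (intro mult_nonneg_nonpos) auto
      with * e show False by simp
    qed
    then have "(q - h0) * (1 - 2 * prob ?Z) \<le> (2 * M) * (1 - 2 * prob ?Z)"
      using h0 qM by (intro mult_right_mono) auto
    with * have "e \<le> (2 * M) * (1 - 2 * prob ?Z)" by linarith
    then have "prob ?Z \<le> 1/2 - e / (4 * M)" using M by (simp add: field_simps)
    moreover have "prob {c \<in> space D. h0 < X c \<and> \<tau> < risk (X c)} \<le> prob ?Z"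
      using sub q by (intro finite_measure_mono) auto
    ultimately show ?thesis by linarith
  qed
qed

text \<open>Reflection, by which results on values above \<open>h0\<close> also cover values below
  it.\<close>

lemma bounded_sample_uminus: "bounded_sample D (\<lambda>c. - X c) M"
  by unfold_locales (use X_le in auto)

lemma risk_uminus: "bounded_sample.risk D (\<lambda>c. - X c) h = risk (- h)"
proof -
  have "\<bar>- X c - h\<bar> = \<bar>X c - - h\<bar>" for c by linarith
  then show ?thesis by (simp add: bounded_sample.risk_def[OF bounded_sample_uminus] risk_def)
qed

end

text \<open>Move \<open>h\<close> down to the largest sample outside \<open>B\<close>. The samples
  outside \<open>B\<close> are a strict majority and come closer by the full shift; the others
  recede by at most that.\<close>

lemma sum_dist_sample_less:
  fixes x :: "nat \<Rightarrow> real"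
  assumes few: "2 * card {j. j < s \<and> x j \<in> B} < s"
    and B: "\<And>j. j < s \<Longrightarrow> x j \<notin> B \<Longrightarrow> x j < h"
  shows "\<exists>j<s. (\<Sum>i<s. \<bar>x i - x j\<bar>) < (\<Sum>i<s. \<bar>x i - h\<bar>)"
proof -
  define N where "N = {j. j < s \<and> x j \<notin> B}"
  let ?B = "{j. j < s \<and> x j \<in> B}"
  have "card (?B \<union> N) = card ?B + card N"
    by (rule card_Un_disjoint) (auto simp: N_def)
  moreover have "?B \<union> N = {..<s}" by (auto simp: N_def)
  ultimately have card: "s = card ?B + card N" by simp
  have fin: "finite N" by (simp add: N_def)
  have "N \<noteq> {}" using few card by auto
  then have "Max (x ` N) \<in> x ` N" using fin by (intro Max_in) auto
  then obtain j where j: "j \<in> N" "x j = Max (x ` N)" by (metis imageE)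
  have le: "x i \<le> x j" if "i \<in> N" for i using that fin by (simp add: j)
  have jh: "j < s" "x j < h" using j(1) B by (simp_all add: N_def)
  have "(\<Sum>i<s. \<bar>x i - x j\<bar> - \<bar>x i - h\<bar>) \<le> (\<Sum>i<s. (h - x j) * (if x i \<in> B then 1 else -1))"
  proof (rule sum_mono)
    fix i assume "i \<in> {..<s}"
    then show "\<bar>x i - x j\<bar> - \<bar>x i - h\<bar> \<le> (h - x j) * (if x i \<in> B then 1 else -1)"
      using le[of i] jh by (auto simp: N_def)
  qed
  also have "\<dots> = (h - x j) * (real (card ?B) - real (card N))"
  proof -
    have "{..<s} \<inter> {i. x i \<in> B} = ?B" "{..<s} \<inter> - {i. x i \<in> B} = N" by (auto simp: N_def)
    then show ?thesis by (simp add: sum_distrib_left[symmetric] sum.If_cases)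
  qed
  also have "\<dots> < 0" using jh few card by (intro mult_pos_neg) auto
  finally show ?thesis using jh by (auto simp: sum_subtractf)
qed

text \<open>If the estimate is bad and above \<open>h0\<close>, convexity makes all samples at or
  beyond it bad. When bad samples on that side are a minority, \<open>sum_dist_sample_less\<close>
  gives a sample with smaller empirical loss, against optimality.\<close>

lemma (in bounded_sample) prob_empirical_median_good:
  assumes e: "0 < e" "e \<le> M" and s: "0 < s" and h0: "\<bar>h0\<bar> \<le> M" and \<tau>: "risk h0 + e \<le> \<tau>"
    and x: "0 \<le> x" "x \<le> e / (4 * M)" "16 * real s * x\<^sup>2 \<le> 1"
    and opt: "\<And>w j. w \<in> space (\<Pi>\<^sub>M j\<in>{..<s}. D) \<Longrightarrow> j < s \<Longrightarrow>
      (\<Sum>i<s. \<bar>X (w i) - est w\<bar>) \<le> (\<Sum>i<s. \<bar>X (w i) - X (w j)\<bar>)"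
    and meas: "{w \<in> space (\<Pi>\<^sub>M j\<in>{..<s}. D). risk (est w) \<le> \<tau>} \<in> sets (\<Pi>\<^sub>M j\<in>{..<s}. D)"
  shows "real s * x\<^sup>2 / 2 \<le> measure (\<Pi>\<^sub>M j\<in>{..<s}. D) {w \<in> space (\<Pi>\<^sub>M j\<in>{..<s}. D). risk (est w) \<le> \<tau>}"
proof -
  interpret neg: bounded_sample D "\<lambda>c. - X c" M by (rule bounded_sample_uminus)
  let ?P = "\<Pi>\<^sub>M j\<in>{..<s}. D"
  interpret P: prob_space ?P by (rule prob_space_PiM) (rule prob_space_axioms)
  \<comment> \<open>The bad samples below \<open>h0\<close>, phrased for the negated variable so
    that the lemmas on values above \<open>h0\<close> apply.\<close>
  define A where "A = {c \<in> space D. - h0 < - X c \<and> \<tau> < neg.risk (- X c)}"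
  define B where "B = {c \<in> space D. h0 < X c \<and> \<tau> < risk (X c)}"
  have M: "0 < M" using e by simp
  have sets: "A \<in> sets D" "B \<in> sets D" unfolding A_def B_def by measurable
  have "prob A \<le> 1/2 - e / (4 * M)" unfolding A_def
    using h0 e \<tau> by (intro neg.prob_risk_large_above) (auto simp: risk_uminus)
  moreover have "prob B \<le> 1/2 - e / (4 * M)" unfolding B_def
    using h0 e \<tau> by (intro prob_risk_large_above) auto
  ultimately have "real s * x\<^sup>2 / 2 \<le> measure ?P {w \<in> space ?P.
      2 * card {j. j < s \<and> w j \<in> A} < s \<and> 2 * card {j. j < s \<and> w j \<in> B} < s}"
    using s x sets by (intro prob_counts_below_half_ge prob_space_axioms) (auto simp: A_def B_def)
  also have "\<dots> \<le> measure ?P {w \<in> space ?P. risk (est w) \<le> \<tau>}"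
  proof (intro P.finite_measure_mono meas subsetI CollectI conjI)
    fix w assume "w \<in> {w \<in> space ?P. 2 * card {j. j < s \<and> w j \<in> A} < s \<and> 2 * card {j. j < s \<and> w j \<in> B} < s}"
    then have w: "w \<in> space ?P" and few: "2 * card {j. j < s \<and> w j \<in> A} < s" "2 * card {j. j < s \<and> w j \<in> B} < s"
      by auto
    have wj: "w j \<in> space D" if "j < s" for j using w that by (auto simp: space_PiM)
    show "w \<in> space ?P" by fact
    show "risk (est w) \<le> \<tau>"
    proof (rule ccontr)
      assume "\<not> risk (est w) \<le> \<tau>"
      then have bad: "\<tau> < risk (est w)" by simp
      then have "est w \<noteq> h0" using \<tau> e by auto
      then consider "h0 < est w" | "- h0 < - est w" by linarith
      then show False
      proof cases
        case 1
        let ?B = "{y. h0 < y \<and> \<tau> < risk y}"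
        have eq: "{j. j < s \<and> X (w j) \<in> ?B} = {j. j < s \<and> w j \<in> B}" using wj by (auto simp: B_def)
        have "\<exists>j<s. (\<Sum>i<s. \<bar>X (w i) - X (w j)\<bar>) < (\<Sum>i<s. \<bar>X (w i) - est w\<bar>)"
        proof (rule sum_dist_sample_less[where B = ?B])
          show "2 * card {j. j < s \<and> X (w j) \<in> ?B} < s" unfolding eq by fact
          show "X (w j) < est w" if "j < s" "X (w j) \<notin> ?B" for j
          proof (rule ccontr)
            assume "\<not> X (w j) < est w"
            have "\<tau> < risk (X (w j))"
              by (rule risk_increasing_above[of h0 "est w"])
                (use 1 bad \<tau> e \<open>\<not> X (w j) < est w\<close> in auto)
            then show False using that 1 \<open>\<not> X (w j) < est w\<close> by auto
          qed
        qed
        then obtain j where "j < s" "(\<Sum>i<s. \<bar>X (w i) - X (w j)\<bar>) < (\<Sum>i<s. \<bar>X (w i) - est w\<bar>)" by blast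
        with opt[OF w, of j] show False by simp
      next
        case 2
        let ?B = "{y. - h0 < y \<and> \<tau> < neg.risk y}"
        have eq: "{j. j < s \<and> - X (w j) \<in> ?B} = {j. j < s \<and> w j \<in> A}" using wj by (auto simp: A_def)
        have "\<exists>j<s. (\<Sum>i<s. \<bar>- X (w i) - - X (w j)\<bar>) < (\<Sum>i<s. \<bar>- X (w i) - - est w\<bar>)"
        proof (rule sum_dist_sample_less[where B = ?B])
          show "2 * card {j. j < s \<and> - X (w j) \<in> ?B} < s" unfolding eq by fact
          show "- X (w j) < - est w" if "j < s" "- X (w j) \<notin> ?B" for j
          proof (rule ccontr)
            assume "\<not> - X (w j) < - est w"
            have "\<tau> < neg.risk (- X (w j))"
              by (rule neg.risk_increasing_above[of "- h0" "- est w"])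
                (use 2 bad \<tau> e \<open>\<not> - X (w j) < - est w\<close> in \<open>auto simp: risk_uminus\<close>)
            then show False using that 2 \<open>\<not> - X (w j) < - est w\<close> by auto
          qed
        qed
        then obtain j where j: "j < s" "(\<Sum>i<s. \<bar>- X (w i) - - X (w j)\<bar>) < (\<Sum>i<s. \<bar>- X (w i) - - est w\<bar>)" by blast
        have "\<bar>- a - - b\<bar> = \<bar>a - b\<bar>" for a b :: real by linarith
        with j(2) opt[OF w j(1)] show False by (simp only: not_le[symmetric]) simp
      qed
    qed
  qed
  finally show ?thesis .
qed

subsection \<open>Sample complexity of empirical loss minimisation\<close>

text \<open>\<open>a + b * (1 - 2 * a)\<close> is the exclusive or of two 0/1 values, written
  affinely in \<open>b\<close> as \<open>empirical_loss_deviation_le\<close> requires. It selects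
  the thresholds between \<open>x\<close> and \<open>h\<close>.\<close>

lemma integral_threshold_mismatch:
  fixes x h M :: real
  assumes M: "0 < M" and x: "x \<in> {-M..M}" and h: "h \<in> {-M..M}"
  shows "(LINT t|uniform_measure lborel {-M..M}.
    indicator {h..} t + indicator {x..} t * (1 - 2 * indicator {h..} t)) = \<bar>x - h\<bar> / (2 * M)"
proof -
  let ?U = "uniform_measure lborel {-M..M}"
  have "indicator {h..} t + indicator {x..} t * (1 - 2 * indicator {h..} t) =
      (indicator {min x h..<max x h} t :: real)" for t
    by (auto simp: indicator_def)
  then have "(LINT t|?U. indicator {h..} t + indicator {x..} t * (1 - 2 * indicator {h..} t)) =
      measure ?U {min x h..<max x h}" by simp
  also have "\<dots> = measure lborel ({-M..M} \<inter> {min x h..<max x h}) / measure lborel {-M..M}"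
    using M by (intro measure_uniform_measure) auto
  also have "{-M..M} \<inter> {min x h..<max x h} = {min x h..<max x h}" using x h by auto
  finally show ?thesis using M by (simp add: max_def min_def)
qed

text \<open>A coordinate and a threshold drawn uniformly turn the whole loss into one mean mismatch,
  so a single deviation handles all coordinates and hints.\<close>

lemma uniform_deviation_l1_loss:
  fixes D :: "(nat \<Rightarrow> real) measure"
  assumes d: "1 \<le> d" and hopt[measurable]: "hopt \<in> Rvec m \<rightarrow>\<^sub>M Rvec d"
    and range: "\<And>c i. c \<in> space (Rvec m) \<Longrightarrow> i < d \<Longrightarrow> hopt c i \<in> {-M..M}"
    and M: "0 < M" and D: "prob_space D" and sD: "sets D = sets (Rvec m)"
    and s: "0 < s" and \<epsilon>: "0 < \<epsilon>"
  obtains V where "V \<in> borel_measurable (\<Pi>\<^sub>M j\<in>{..<s}. D)"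
    and "measure (\<Pi>\<^sub>M j\<in>{..<s}. D) {w \<in> space (\<Pi>\<^sub>M j\<in>{..<s}. D). \<epsilon> \<le> V w}
      \<le> 2 * exp (- (real s * (\<epsilon> / (real d * M))\<^sup>2 / 2))"
    and "\<forall>w\<in>space (\<Pi>\<^sub>M j\<in>{..<s}. D). \<forall>h. (\<forall>i<d. h i \<in> {-M..M}) \<longrightarrow>
      \<bar>(\<Sum>j<s. l1_loss d hopt h (w j)) / real s - exp_loss d hopt D h\<bar> \<le> V w"
proof -
  define U where "U = uniform_measure lborel {-M..M}"
  define p where "p = pmf_of_set {..<d}"
  define Q where "Q = measure_pmf p \<Otimes>\<^sub>M U"
  define g where "g t c = (indicator {hopt c (fst t)..} (snd t) :: real)" for t :: "nat \<times> real" and c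
  \<comment> \<open>Undoes two normalisations: \<open>d\<close> for the random coordinate and
    \<open>2 * M\<close> for the uniform threshold.\<close>
  define K where "K = 2 * M * real d"
  have K: "0 < K" using M d by (simp add: K_def)
  have p: "finite {..<d}" "{..<d} \<noteq> {}" using d by (auto simp: lessThan_empty_iff)
  interpret U: prob_space U unfolding U_def using M by (intro prob_space_uniform_measure) auto
  interpret pU: pair_prob_space "measure_pmf p" U ..
  have Q: "prob_space Q" unfolding Q_def by unfold_locales
  interpret Q: prob_space Q by fact
  have sp: "space D = space (Rvec m)" using sD by (rule sets_eq_imp_space_eq)
  have fst[measurable]: "fst \<in> Q \<rightarrow>\<^sub>M count_space UNIV"
    unfolding Q_def using measurable_fst[of "measure_pmf p" U]
    by (simp cong: measurable_cong_sets)
  have snd[measurable]: "snd \<in> borel_measurable Q"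
    unfolding Q_def using measurable_snd[of "measure_pmf p" U]
    by (simp add: U_def cong: measurable_cong_sets)
  have hoptD: "hopt \<in> D \<rightarrow>\<^sub>M Rvec d" using hopt by (simp cong: measurable_cong_sets add: sD)
  \<comment> \<open>The coordinate index ranges over all naturals as a measurable space; beyond
    \<open>d\<close>, extensionality fixes the value \<open>undefined\<close>.\<close>
  have hi: "(\<lambda>c. hopt c i) \<in> borel_measurable D" for i
  proof (cases "i < d")
    case True
    then show ?thesis using measurable_compose[OF hoptD measurable_component_singleton] by simp
  next
    case False
    have "hopt c i = undefined" if "c \<in> space D" for c
      using measurable_space[OF hoptD that] False by (auto simp: space_PiM PiE_def extensional_def)
    then show ?thesis by (subst measurable_cong[where g = "\<lambda>_. undefined"]) auto
  qed
  have g: "(\<lambda>(t, c). g t c) \<in> borel_measurable (Q \<Otimes>\<^sub>M D)"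
  proof -
    have [measurable]: "(\<lambda>x. hopt (snd x) (fst (fst x))) \<in> borel_measurable (Q \<Otimes>\<^sub>M D)"
      by (rule measurable_compose_countable[where g = "\<lambda>x. fst (fst x)" and f = "\<lambda>i x. hopt (snd x) i"])
        (auto intro: measurable_compose[OF measurable_snd hi] measurable_compose[OF measurable_fst fst])
    have [measurable]: "(\<lambda>x. snd (fst x)) \<in> borel_measurable (Q \<Otimes>\<^sub>M D)"
      by (rule measurable_compose[OF measurable_fst snd])
    have "(\<lambda>x. if hopt (snd x) (fst (fst x)) \<le> snd (fst x) then 1 else 0 :: real) \<in> borel_measurable (Q \<Otimes>\<^sub>M D)"
      by measurable
    then show ?thesis by (simp add: g_def split_beta' indicator_def)
  qed
  have g01: "0 \<le> g t c \<and> g t c \<le> 1" for t c by (simp add: g_def indicator_def)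
  define V where "V w = K * (LINT t|Q. \<bar>(\<Sum>j<s. g t (w j)) / real s - (LINT c|D. g t c)\<bar>)" for w
  have l: "0 < \<epsilon> / K" using \<epsilon> K by simp
  show ?thesis
  proof (rule that[of V])
    show "V \<in> borel_measurable (\<Pi>\<^sub>M j\<in>{..<s}. D)"
      using prob_L1_deviation_ge(1)[OF D Q g g01 s l] unfolding V_def by simp
    have "(\<epsilon> \<le> V w) \<longleftrightarrow> \<epsilon> / K \<le> (LINT t|Q. \<bar>(\<Sum>j<s. g t (w j)) / real s - (LINT c|D. g t c)\<bar>)" for w
      using K by (simp add: V_def pos_divide_le_eq mult.commute)
    moreover have "- 2 * real s * (\<epsilon> / K)\<^sup>2 = - (real s * (\<epsilon> / (real d * M))\<^sup>2 / 2)"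
      using M d by (simp add: K_def power2_eq_square field_simps)
    ultimately show "measure (\<Pi>\<^sub>M j\<in>{..<s}. D) {w \<in> space (\<Pi>\<^sub>M j\<in>{..<s}. D). \<epsilon> \<le> V w}
      \<le> 2 * exp (- (real s * (\<epsilon> / (real d * M))\<^sup>2 / 2))"
      using prob_L1_deviation_ge(2)[OF D Q g g01 s l] by (simp only:)
  next
    show "\<forall>w\<in>space (\<Pi>\<^sub>M j\<in>{..<s}. D). \<forall>h. (\<forall>i<d. h i \<in> {-M..M}) \<longrightarrow>
      \<bar>(\<Sum>j<s. l1_loss d hopt h (w j)) / real s - exp_loss d hopt D h\<bar> \<le> V w"
    proof (intro ballI allI impI)
      fix w and h :: "nat \<Rightarrow> real"
      assume w: "w \<in> space (\<Pi>\<^sub>M j\<in>{..<s}. D)" and h: "\<forall>i<d. h i \<in> {-M..M}"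
      define \<eta> where "\<eta> t = (indicator {h (fst t)..} (snd t) :: real)" for t :: "nat \<times> real"
      define \<sigma> where "\<sigma> t = 1 - 2 * \<eta> t" for t
      have \<eta>[measurable]: "\<eta> \<in> borel_measurable Q"
      proof -
        have [measurable]: "(\<lambda>t. h (fst t)) \<in> borel_measurable Q"
          by (rule measurable_compose[OF fst]) simp
        have "(\<lambda>t. if h (fst t) \<le> snd t then 1 else 0 :: real) \<in> borel_measurable Q" by measurable
        then show ?thesis by (simp add: \<eta>_def[abs_def] indicator_def)
      qed
      have \<sigma>: "\<sigma> \<in> borel_measurable Q" unfolding \<sigma>_def by measurable
      show "\<bar>(\<Sum>j<s. l1_loss d hopt h (w j)) / real s - exp_loss d hopt D h\<bar> \<le> V w"
        unfolding V_def exp_loss_def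
      proof (rule empirical_loss_deviation_le[OF D Q g g01 s less_imp_le[OF K] \<eta> \<sigma> _ _ _ w])
        show "\<bar>\<eta> t\<bar> \<le> 1" "\<bar>\<sigma> t\<bar> \<le> 1" for t by (auto simp: \<sigma>_def \<eta>_def indicator_def)
        fix c assume c: "c \<in> space D"
        have [measurable]: "(\<lambda>t. g t c) \<in> borel_measurable Q"
          using measurable_compose[OF measurable_Pair2'[OF c] g] by simp
        have "integrable Q (\<lambda>t. \<eta> t + g t c * \<sigma> t)"
          using \<sigma> by (intro Q.integrable_const_bound[of _ 2]) (auto simp: \<sigma>_def \<eta>_def g_def indicator_def)
        then have "(LINT t|Q. \<eta> t + g t c * \<sigma> t) = (LINT i|measure_pmf p. LINT t|U. \<eta> (i, t) + g (i, t) c * \<sigma> (i, t))"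
          unfolding Q_def by (subst pU.integral_fst'[symmetric]) auto
        also have "\<dots> = (\<Sum>i<d. LINT t|U. \<eta> (i, t) + g (i, t) c * \<sigma> (i, t)) / real d"
          unfolding p_def using p by (subst integral_pmf_of_set) auto
        also have "(\<Sum>i<d. LINT t|U. \<eta> (i, t) + g (i, t) c * \<sigma> (i, t)) = (\<Sum>i<d. \<bar>hopt c i - h i\<bar> / (2 * M))"
          using range c h M integral_threshold_mismatch[of M]
          by (intro sum.cong refl) (simp add: \<eta>_def g_def \<sigma>_def U_def sp)
        finally show "l1_loss d hopt h c = K * (LINT t|Q. \<eta> t + g t c * \<sigma> t)"
          using M d by (simp add: l1_loss_def K_def sum_divide_distrib[symmetric])
      qed
    qed
  qed
qed

lemma exp_loss_measurable:
  assumes hopt: "hopt \<in> Rvec m \<rightarrow>\<^sub>M Rvec d" and D: "prob_space D" and sD: "sets D = sets (Rvec m)"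
  shows "exp_loss d hopt D \<in> borel_measurable (Rvec d)"
proof -
  interpret prob_space D by fact
  have hoptD[measurable]: "hopt \<in> D \<rightarrow>\<^sub>M Rvec d"
    using hopt by (simp cong: measurable_cong_sets add: sD)
  have "(\<lambda>x. l1_loss d hopt (fst x) (snd x)) \<in> borel_measurable (Rvec d \<Otimes>\<^sub>M D)"
    unfolding l1_loss_def
  proof (intro borel_measurable_sum borel_measurable_abs borel_measurable_diff)
    fix i assume "i \<in> {..<d}"
    then have c: "(\<lambda>y. y i) \<in> borel_measurable (Rvec d)" by simp
    show "(\<lambda>x. hopt (snd x) i) \<in> borel_measurable (Rvec d \<Otimes>\<^sub>M D)"
      by (rule measurable_compose[OF measurable_compose[OF measurable_snd hoptD] c])
    show "(\<lambda>x. fst x i) \<in> borel_measurable (Rvec d \<Otimes>\<^sub>M D)"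
      by (rule measurable_compose[OF measurable_fst c])
  qed
  then show ?thesis unfolding exp_loss_def[abs_def]
    by (intro borel_measurable_lebesgue_integral) (simp add: split_beta')
qed

lemma sum_list_samples: "(\<Sum>c\<leftarrow>map w [0..<s]. f c) = (\<Sum>j<s. f (w j))"
  by (simp add: interv_sum_list_conv_sum_set_nat atLeast0LessThan)

text \<open>Stated for an arbitrary measurable empirical minimiser, which separates the statistics
  from the machine model.\<close>

lemma erm_sample_bound:
  fixes D :: "(nat \<Rightarrow> real) measure"
  assumes d: "1 \<le> d" and hopt: "hopt \<in> Rvec m \<rightarrow>\<^sub>M Rvec d"
    and hoptH: "\<And>c. c \<in> space (Rvec m) \<Longrightarrow> hopt c \<in> H"
    and HM: "\<And>h i. h \<in> H \<Longrightarrow> i < d \<Longrightarrow> h i \<in> {-M..M}"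
    and D: "prob_space D" and sD: "sets D = sets (Rvec m)"
    and \<epsilon>: "0 < \<epsilon>" and \<delta>: "0 < \<delta>" "\<delta> < 1"
    and s: "512 * (real d * M / \<epsilon>)\<^sup>2 * (real d * ln (real d) + ln (1 / \<delta>)) \<le> real s"
    and est[measurable]: "est \<in> (\<Pi>\<^sub>M j\<in>{..<s}. D) \<rightarrow>\<^sub>M Rvec d"
    and estH: "\<And>w. w \<in> space (\<Pi>\<^sub>M j\<in>{..<s}. D) \<Longrightarrow> est w \<in> H"
    and opt: "\<And>w h. w \<in> space (\<Pi>\<^sub>M j\<in>{..<s}. D) \<Longrightarrow> h \<in> H \<Longrightarrow>
      (\<Sum>j<s. l1_loss d hopt (est w) (w j)) \<le> (\<Sum>j<s. l1_loss d hopt h (w j))"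
  shows "1 - \<delta> \<le> measure (\<Pi>\<^sub>M j\<in>{..<s}. D) {w \<in> space (\<Pi>\<^sub>M j\<in>{..<s}. D).
    exp_loss d hopt D (est w) \<le> (INF h\<in>H. exp_loss d hopt D h) + \<epsilon>}"
proof -
  let ?P = "\<Pi>\<^sub>M j\<in>{..<s}. D" and ?L = "exp_loss d hopt D"
  define I where "I = (INF h\<in>H. ?L h)"
  define E where "E = {w \<in> space ?P. ?L (est w) \<le> I + \<epsilon>}"
  interpret D: prob_space D by fact
  interpret P: prob_space ?P by (rule prob_space_PiM) (rule D)
  have sp: "space D = space (Rvec m)" using sD by (rule sets_eq_imp_space_eq)
  note exp_loss_measurable[OF hopt D sD, measurable]
  have E: "E \<in> sets ?P" unfolding E_def by measurable
  have hoptM: "hopt c i \<in> {-M..M}" if "c \<in> space (Rvec m)" "i < d" for c i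
    using HM[OF hoptH] that .
  obtain c0 where "c0 \<in> space D" using D.not_empty by auto
  then have H0: "H \<noteq> {}" using hoptH sp by auto
  have hoptD: "hopt \<in> D \<rightarrow>\<^sub>M Rvec d" using hopt by (simp cong: measurable_cong_sets add: sD)
  have L0: "0 \<le> ?L h" for h
    unfolding exp_loss_def l1_loss_def by (intro integral_nonneg_AE AE_I2 sum_nonneg) auto
  have bdd: "bdd_below (?L ` H)" by (rule bdd_belowI2[of _ 0]) (rule L0)
  have I0: "0 \<le> I" unfolding I_def using H0 L0 by (intro cINF_greatest) auto
  have LM: "?L h \<le> 2 * M * real d" if h: "h \<in> H" for h
  proof -
    have l: "l1_loss d hopt h c \<le> 2 * M * real d" if c: "c \<in> space D" for c
    proof -
      have "\<bar>hopt c i - h i\<bar> \<le> 2 * M" if "i < d" for i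
        using hoptM[of c i] HM[OF h, of i] c sp that by auto
      then have "l1_loss d hopt h c \<le> (\<Sum>i<d. 2 * M)"
        unfolding l1_loss_def by (intro sum_mono) auto
      then show ?thesis by (simp add: mult_ac)
    qed
    have hi: "(\<lambda>c. hopt c i) \<in> borel_measurable D" if "i < d" for i
      using that measurable_compose[OF hoptD measurable_component_singleton] by simp
    have "l1_loss d hopt h \<in> borel_measurable D"
      unfolding l1_loss_def[abs_def] using hi by (intro borel_measurable_sum) simp
    moreover have "0 \<le> l1_loss d hopt h c" for c unfolding l1_loss_def by (intro sum_nonneg) auto
    ultimately have "integrable D (l1_loss d hopt h)"
      using l by (intro D.integrable_const_bound[of _ "2 * M * real d"]) (auto intro: AE_I2)
    then have "?L h \<le> (LINT c|D. 2 * M * real d)"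
      unfolding exp_loss_def using l by (intro integral_mono) auto
    then show ?thesis by (simp add: D.prob_space)
  qed
  have "1 - \<delta> \<le> measure ?P E"
  \<comment> \<open>In the first case every hint is good, as losses are at most
    \<open>2 * M * d\<close> and the infimum is nonnegative. In the other, \<open>M\<close> is
    positive.\<close>
  proof (cases "2 * M * real d \<le> \<epsilon>")
    case True
    have "?L (est w) \<le> I + \<epsilon>" if "w \<in> space ?P" for w
      using LM[OF estH[OF that]] True I0 by linarith
    then have "E = space ?P" by (auto simp: E_def)
    then show ?thesis using \<delta> by (simp add: P.prob_space)
  next
    case False
    then have dM: "0 < real d * M" using \<epsilon> by (simp add: mult_ac)
    then have M: "0 < M" using d by (simp add: zero_less_mult_iff)
    \<comment> \<open>The sample size in units of \<open>(d * M / \<epsilon>)^2\<close>; the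
      hypothesis becomes \<open>512 * (T + b) \<le> y\<close>.\<close>
    define y where "y = real s * (\<epsilon> / (real d * M))\<^sup>2"
    define b where "b = ln (1 / \<delta>)"
    define T where "T = real d * ln (real d)"
    have l\<delta>: "0 < b" using \<delta> by (simp add: b_def)
    have dl: "0 \<le> T" using d by (simp add: T_def)
    have y: "512 * (T + b) \<le> y"
    proof -
      have "512 * (T + b) =
          512 * (real d * M / \<epsilon>)\<^sup>2 * (T + b) * (\<epsilon> / (real d * M))\<^sup>2"
        using dM \<epsilon> M d by (simp add: power_divide field_simps)
      also have "\<dots> \<le> y" unfolding y_def by (rule mult_right_mono[OF s[folded b_def T_def]]) simp
      finally show ?thesis .
    qed
    have "0 < 512 * (T + b)" using l\<delta> dl by (intro mult_pos_pos add_nonneg_pos) auto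
    from this y have y0: "0 < y" by (rule less_le_trans)
    have y: "512 * T + 512 * b \<le> y" using y by (simp only: distrib_left)
    have s0: "0 < s" using y0 by (cases s) (auto simp: y_def)
    \<comment> \<open>A deviation below \<open>\<epsilon> / 2\<close> is spent twice, on the
      estimate and on its competitor; halving \<open>\<epsilon>\<close> turns the exponent
      \<open>y / 2\<close> into \<open>y / 8\<close>.\<close>
    have tail: "1 - 2 * exp (- (y / 8)) \<le> measure ?P E"
    proof -
      obtain V where V[measurable]: "V \<in> borel_measurable ?P"
        and tail: "measure ?P {w \<in> space ?P. \<epsilon> / 2 \<le> V w} \<le> 2 * exp (- (real s * (\<epsilon> / 2 / (real d * M))\<^sup>2 / 2))"
        and dev: "\<forall>w\<in>space ?P. \<forall>h. (\<forall>i<d. h i \<in> {-M..M}) \<longrightarrow>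
          \<bar>(\<Sum>j<s. l1_loss d hopt h (w j)) / real s - ?L h\<bar> \<le> V w"
        using uniform_deviation_l1_loss[OF d hopt hoptM M D sD s0 half_gt_zero[OF \<epsilon>]] .
      let ?B = "{w \<in> space ?P. \<epsilon> / 2 \<le> V w}"
      have B: "?B \<in> sets ?P" by measurable
      have "space ?P - ?B \<subseteq> E"
      proof
        fix w assume "w \<in> space ?P - ?B"
        then have w: "w \<in> space ?P" and Vw: "V w < \<epsilon> / 2" by auto
        have "?L (est w) - \<epsilon> \<le> ?L h" if h: "h \<in> H" for h
        proof -
          have "(\<Sum>j<s. l1_loss d hopt (est w) (w j)) / real s \<le> (\<Sum>j<s. l1_loss d hopt h (w j)) / real s"
            using opt[OF w h] by (rule divide_right_mono) simp
          moreover have "\<bar>(\<Sum>j<s. l1_loss d hopt h (w j)) / real s - ?L h\<bar> \<le> V w"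
            using dev w HM[OF h] by blast
          moreover have "\<bar>(\<Sum>j<s. l1_loss d hopt (est w) (w j)) / real s - ?L (est w)\<bar> \<le> V w"
            using dev w HM[OF estH[OF w]] by blast
          ultimately show ?thesis using Vw by linarith
        qed
        then have "?L (est w) - \<epsilon> \<le> I" unfolding I_def using H0 by (intro cINF_greatest) auto
        then show "w \<in> E" using w by (simp add: E_def)
      qed
      then have "P.prob (space ?P - ?B) \<le> P.prob E" using E by (rule P.finite_measure_mono)
      moreover have "P.prob (space ?P - ?B) = 1 - P.prob ?B" using B by (rule P.prob_compl)
      moreover have "real s * (\<epsilon> / 2 / (real d * M))\<^sup>2 / 2 = y / 8"
        by (simp add: y_def power2_eq_square)
      ultimately show ?thesis using tail by (simp only:)
    qed
    have ed: "exp (- b) = \<delta>" using \<delta> by (simp add: b_def ln_div)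
    show ?thesis
    proof (cases "2 \<le> d")
      case True
      have "1 * ln 2 \<le> T" unfolding T_def using True by (intro mult_mono) auto
      then have "ln 2 + b \<le> y / 8" using y y0 l\<delta> by linarith
      then have "exp (- (y / 8)) \<le> exp (- ln 2 + - b)" by simp
      also have "\<dots> = \<delta> / 2" unfolding exp_add ed by (simp add: exp_minus)
      finally show ?thesis using tail by simp
    next
      case False
      then have d1: "d = 1" using d by simp
      have y': "b \<le> y / 512" using y dl by linarith
      show ?thesis
      proof (cases "16 \<le> y")
        case True
        \<comment> \<open>The factor 2 is at most \<open>exp 1\<close>, and
          \<open>1 \<le> y / 16\<close> leaves \<open>y / 16\<close> of the exponent, which exceeds
          \<open>b\<close>.\<close>
        have "2 * exp (- (y / 8)) \<le> exp 1 * exp (- (y / 8))"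
          using exp_ge_add_one_self[of 1] by (intro mult_right_mono) auto
        also have "\<dots> = exp (1 - y / 8)" by (simp add: exp_add[symmetric])
        also have "\<dots> \<le> exp (- b)" using y' True by simp
        finally show ?thesis using tail ed by simp
      next
        case y16: False
        interpret X: bounded_sample D "\<lambda>c. hopt c 0" M
        proof
          show "(\<lambda>c. hopt c 0) \<in> borel_measurable D"
            using measurable_compose[OF hoptD measurable_component_singleton] d1 by simp
          show "\<bar>hopt c 0\<bar> \<le> M" if "c \<in> space D" for c
            using hoptM[of c 0] that sp d1 by auto
        qed
        have risk: "?L h = X.risk (h 0)" for h
          by (simp add: exp_loss_def l1_loss_def X.risk_def d1)
        \<comment> \<open>Half of \<open>\<epsilon>\<close> buys a near-minimiser, as the infimum
          need not be attained; the other half is the gap in the median argument.\<close>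
        have "I < I + \<epsilon> / 2" using \<epsilon> by simp
        then obtain h' where h': "h' \<in> H" "?L h' < I + \<epsilon> / 2"
          unfolding I_def using cINF_less_iff[OF H0 bdd] by blast
        \<comment> \<open>Half of the admissible \<open>\<epsilon> / (8 * M)\<close>, so that
          \<open>y < 16\<close> gives \<open>16 * s * x^2 \<le> 1\<close>. Then
          \<open>s * x^2 / 2 = y / 512\<close>, whence the constant 512.\<close>
        define x where "x = \<epsilon> / (16 * M)"
        have xy: "real s * x\<^sup>2 = y / 256"
          by (simp add: x_def y_def d1 power2_eq_square)
        have "real s * x\<^sup>2 / 2 \<le> measure ?P {w \<in> space ?P. X.risk (est w 0) \<le> I + \<epsilon>}"
        proof (rule X.prob_empirical_median_good[of "\<epsilon> / 2" s "h' 0"])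
          show "0 < \<epsilon> / 2" "\<epsilon> / 2 \<le> M" "0 < s" using \<epsilon> s0 \<open>\<not> 2 * M * real d \<le> \<epsilon>\<close> d1 by auto
          show "\<bar>h' 0\<bar> \<le> M" using HM[OF h'(1), of 0] d1 by auto
          show "X.risk (h' 0) + \<epsilon> / 2 \<le> I + \<epsilon>" using h' by (simp add: risk)
          show "0 \<le> x" "x \<le> \<epsilon> / 2 / (4 * M)" using \<epsilon> M by (auto simp: x_def field_simps)
          show "16 * real s * x\<^sup>2 \<le> 1" using y16 xy by (simp add: mult.assoc)
          show "{w \<in> space ?P. X.risk (est w 0) \<le> I + \<epsilon>} \<in> sets ?P"
            using E by (simp add: E_def risk)
          fix w j assume w: "w \<in> space ?P" and j: "j < s"
          then have "w j \<in> space D" by (auto simp: space_PiM)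
          \<comment> \<open>A sample's own hint lies in \<open>H\<close>, so optimality compares the
            estimate with every sample point.\<close>
          then have "hopt (w j) \<in> H" using hoptH sp by simp
          from opt[OF w this] show "(\<Sum>i<s. \<bar>hopt (w i) 0 - est w 0\<bar>) \<le> (\<Sum>i<s. \<bar>hopt (w i) 0 - hopt (w j) 0\<bar>)"
            by (simp add: l1_loss_def d1)
        qed
        then have "y / 512 \<le> measure ?P E" using xy by (simp add: E_def risk)
        \<comment> \<open>The tangent of the logarithm at 1 turns the demand on
          \<open>ln (1 / \<delta>)\<close> into one on the success probability.\<close>
        moreover have "1 - \<delta> \<le> b" using ln_le_minus_one[of \<delta>] \<delta> by (simp add: b_def ln_div)
        ultimately show ?thesis using y' by linarith
      qed
    qed
  qed
  then show ?thesis by (simp add: E_def I_def)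
qed

theorem theorem6p1:
  "\<exists>C>0. \<forall>(m::nat) (d::nat) (H :: (nat \<Rightarrow> real) set) (hopt :: (nat \<Rightarrow> real) \<Rightarrow> (nat \<Rightarrow> real)) (M::real).
     d \<ge> 1 \<longrightarrow>
     H \<subseteq> space (Rvec d) \<longrightarrow>
     hopt \<in> Rvec m \<rightarrow>\<^sub>M Rvec d \<longrightarrow>
     (\<forall>c \<in> space (Rvec m). hopt c \<in> H) \<longrightarrow>
     (\<forall>h\<in>H. \<forall>i<d. h i \<in> {-M..M}) \<longrightarrow>
     (\<exists>A. poly_time_on (sample_inputs m) A \<and> minimizes_empirical_loss m d H hopt A) \<longrightarrow>
     (\<exists>B. poly_time_on (sample_inputs m) B \<and>
        (\<forall>xs \<in> sample_inputs m. prog_output B d xs \<in> H) \<and>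
        (\<forall>(D :: (nat \<Rightarrow> real) measure) (\<epsilon>::real) (\<delta>::real) (s::nat).
           prob_space D \<longrightarrow> sets D = sets (Rvec m) \<longrightarrow>
           0 < \<epsilon> \<longrightarrow> 0 < \<delta> \<longrightarrow> \<delta> < 1 \<longrightarrow>
           C * (real d * M / \<epsilon>)\<^sup>2 * (real d * ln (real d) + ln (1 / \<delta>)) \<le> real s \<longrightarrow>
           measure (\<Pi>\<^sub>M j\<in>{..<s}. D)
             {\<omega> \<in> space (\<Pi>\<^sub>M j\<in>{..<s}. D).
                exp_loss d hopt D (prog_output B d (encode m (map \<omega> [0..<s])))
                  \<le> (INF h'\<in>H. exp_loss d hopt D h') + \<epsilon>} \<ge> 1 - \<delta>))"
proof (intro exI[of _ 512] conjI allI impI)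
  fix m d :: nat and H :: "(nat \<Rightarrow> real) set" and hopt :: "(nat \<Rightarrow> real) \<Rightarrow> nat \<Rightarrow> real" and M :: real
  assume d: "1 \<le> d" and "H \<subseteq> space (Rvec d)" and hopt: "hopt \<in> Rvec m \<rightarrow>\<^sub>M Rvec d"
    and hoptH: "\<forall>c \<in> space (Rvec m). hopt c \<in> H" and HM: "\<forall>h\<in>H. \<forall>i<d. h i \<in> {-M..M}"
    and "\<exists>A. poly_time_on (sample_inputs m) A \<and> minimizes_empirical_loss m d H hopt A"
  then obtain A where poly: "poly_time_on (sample_inputs m) A"
    and min: "minimizes_empirical_loss m d H hopt A" by blast
  have out: "prog_output A d (encode m cs) \<in> H"
    and opt: "h \<in> H \<Longrightarrow> (\<Sum>c\<leftarrow>cs. l1_loss d hopt (prog_output A d (encode m cs)) c) \<le> (\<Sum>c\<leftarrow>cs. l1_loss d hopt h c)"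
    if "cs \<in> lists (space (Rvec m))" for cs h
    using min that unfolding minimizes_empirical_loss_def is_arg_min_def by (auto simp: not_less)
  show "\<exists>B. poly_time_on (sample_inputs m) B \<and>
        (\<forall>xs \<in> sample_inputs m. prog_output B d xs \<in> H) \<and>
        (\<forall>(D :: (nat \<Rightarrow> real) measure) (\<epsilon>::real) (\<delta>::real) (s::nat).
           prob_space D \<longrightarrow> sets D = sets (Rvec m) \<longrightarrow>
           0 < \<epsilon> \<longrightarrow> 0 < \<delta> \<longrightarrow> \<delta> < 1 \<longrightarrow>
           512 * (real d * M / \<epsilon>)\<^sup>2 * (real d * ln (real d) + ln (1 / \<delta>)) \<le> real s \<longrightarrow>
           measure (\<Pi>\<^sub>M j\<in>{..<s}. D)
             {\<omega> \<in> space (\<Pi>\<^sub>M j\<in>{..<s}. D).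
                exp_loss d hopt D (prog_output B d (encode m (map \<omega> [0..<s])))
                  \<le> (INF h'\<in>H. exp_loss d hopt D h') + \<epsilon>} \<ge> 1 - \<delta>)"
  proof (intro exI[of _ A] conjI poly ballI allI impI)
    show "prog_output A d xs \<in> H" if "xs \<in> sample_inputs m" for xs
      using that out by (auto simp: sample_inputs_def)
    fix D :: "(nat \<Rightarrow> real) measure" and \<epsilon> \<delta> :: real and s :: nat
    assume D: "prob_space D" and sD: "sets D = sets (Rvec m)"
      and rest: "0 < \<epsilon>" "0 < \<delta>" "\<delta> < 1"
        "512 * (real d * M / \<epsilon>)\<^sup>2 * (real d * ln (real d) + ln (1 / \<delta>)) \<le> real s"
    have samples: "map w [0..<s] \<in> lists (space (Rvec m))" if "w \<in> space (\<Pi>\<^sub>M j\<in>{..<s}. D)" for w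
    proof -
      have "w j \<in> space D" if "j < s" for j
        using \<open>w \<in> _\<close> that by (auto simp: space_PiM[of "{..<s}" "\<lambda>_. D"])
      then show ?thesis using sets_eq_imp_space_eq[OF sD] by auto
    qed
    show "1 - \<delta> \<le> measure (\<Pi>\<^sub>M j\<in>{..<s}. D)
             {\<omega> \<in> space (\<Pi>\<^sub>M j\<in>{..<s}. D).
                exp_loss d hopt D (prog_output A d (encode m (map \<omega> [0..<s])))
                  \<le> (INF h'\<in>H. exp_loss d hopt D h') + \<epsilon>}"
    proof (rule erm_sample_bound[OF d hopt _ _ D sD rest])
      show "(\<lambda>w. prog_output A d (encode m (map w [0..<s]))) \<in> (\<Pi>\<^sub>M j\<in>{..<s}. D) \<rightarrow>\<^sub>M Rvec d"
        using measurable_encode_samples[OF sD]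
        by (intro measurable_prog_output[where n = "s * m"]) (auto simp: encode_samples)
      fix w h assume "w \<in> space (\<Pi>\<^sub>M j\<in>{..<s}. D)" "h \<in> H"
      then show "(\<Sum>j<s. l1_loss d hopt (prog_output A d (encode m (map w [0..<s]))) (w j))
          \<le> (\<Sum>j<s. l1_loss d hopt h (w j))"
        using opt[OF samples] by (simp only: sum_list_samples)
    qed (use hoptH HM out samples in auto)
  qed
qed simp

end
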